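(* There is an algorithm that transforms any nondegenerate polynomial map $F:\mathbb{R}^n\to\mathbb{R}^n$ into a map $G:\mathbb{R}^m\to\mathbb{R}^m$ of cubic homogeneous type (where $m$ is generally much larger than $n$), such that (1) $F$ is nonsingular if, and only if, $G$ is nonsingular, and (2) a finite bound on the cardinality of fibers holds for $F$ if, and only if, the same bound holds for $G$; that is, for every positive integer $b$, every fiber of $F$ has at most $b$ elements if, and only if, every fiber of $G$ has at most $b$ elements.
   Context: For a map $F:\mathbb{R}^n\to\mathbb{R}^n$ with Jacobian determinant $j(F)$: $F$ is nondegenerate if $j(F)$ is not identically zero on $\mathbb{R}^n$, and nonsingular if $j(F)\neq 0$ at every point of $\mathbb{R}^n$. A map $G:\mathbb{R}^m\to\mathbb{R}^m$ is of cubic homogeneous type (a Yagzhev map) if it is a polynomial map of the form $G=X+H$, where $X=(x_1,\dots,x_m)$ is the identity and each component of $H$ is a cubic homogeneous polynomial (possibly zero) in $x_1,\dots,x_m$; no further condition on the Jacobian determinant of $G$ is imposed. The fibers of a map are the inverse images of points of the codomain, taken over $\mathbb{R}$. *)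

theory Defs
  imports "HOL-Analysis.Derivative" "Jordan_Normal_Form.Determinant"
begin

unbundle no vec_syntax

text \<open>
  Points of \<open>\<real>\<^sup>n\<close> are the elements of \<^term>\<open>carrier_vec n\<close>, and a map
  \<open>\<real>\<^sup>n \<rightarrow> \<real>\<^sup>n\<close> is a function on vectors of which only the values on \<^term>\<open>carrier_vec n\<close> matter.
\<close>

section \<open>Polynomial maps\<close>

text \<open>
  A polynomial is written as a finite list of terms. The term \<open>(c, [k\<^sub>1, \<dots>, k\<^sub>d])\<close> stands for
  \<open>c x\<^bsub>k\<^sub>1\<^esub> \<cdots> x\<^bsub>k\<^sub>d\<^esub>\<close>, so an exponent is given by repetition of the variable, and variables are
  numbered from 0. The order of terms and variables is free, and terms may repeat or have coefficient 0.
\<close>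

type_synonym terms = "(real \<times> nat list) list"

definition eval_terms :: "terms \<Rightarrow> real Matrix.vec \<Rightarrow> real" where
  "eval_terms p x = (\<Sum>(c, ks)\<leftarrow>p. c * (\<Prod>k\<leftarrow>ks. x $ k))"

definition vars_below :: "nat \<Rightarrow> terms \<Rightarrow> bool" where
  "vars_below n p \<longleftrightarrow> (\<forall>(c, ks)\<in>set p. \<forall>k\<in>set ks. k < n)"

definition homogeneous :: "nat \<Rightarrow> terms \<Rightarrow> bool" where
  "homogeneous d p \<longleftrightarrow> (\<forall>(c, ks)\<in>set p. length ks = d)"

text \<open>\<open>presents n P F\<close>: \<open>F\<close> is a polynomial map \<open>\<real>\<^sup>n \<rightarrow> \<real>\<^sup>n\<close> with components written as \<open>P\<close>.\<close>

definition presents :: "nat \<Rightarrow> terms list \<Rightarrow> (real Matrix.vec \<Rightarrow> real Matrix.vec) \<Rightarrow> bool" where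
  "presents n P F \<longleftrightarrow> length P = n \<and> (\<forall>p\<in>set P. vars_below n p) \<and>
     (\<forall>x\<in>carrier_vec n. F x = Matrix.vec n (\<lambda>i. eval_terms (P ! i) x))"

definition polynomial_map :: "nat \<Rightarrow> (real Matrix.vec \<Rightarrow> real Matrix.vec) \<Rightarrow> bool" where
  "polynomial_map n F \<longleftrightarrow> (\<exists>P. presents n P F)"

definition cubic_homogeneous_type :: "nat \<Rightarrow> (real Matrix.vec \<Rightarrow> real Matrix.vec) \<Rightarrow> bool" where
  "cubic_homogeneous_type m G \<longleftrightarrow>
     (\<exists>H P. presents m P H \<and> (\<forall>p\<in>set P. homogeneous 3 p) \<and> (\<forall>x\<in>carrier_vec m. G x = x + H x))"

definition jacobian_det :: "nat \<Rightarrow> (real Matrix.vec \<Rightarrow> real Matrix.vec) \<Rightarrow> real Matrix.vec \<Rightarrow> real" where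
  "jacobian_det n F x =
     Determinant.det (Matrix.mat n n (\<lambda>(i, j). deriv (\<lambda>t. F (x + t \<cdot>\<^sub>v unit_vec n j) $ i) 0))"

definition nondegenerate :: "nat \<Rightarrow> (real Matrix.vec \<Rightarrow> real Matrix.vec) \<Rightarrow> bool" where
  "nondegenerate n F \<longleftrightarrow> (\<exists>x\<in>carrier_vec n. jacobian_det n F x \<noteq> 0)"

definition nonsingular :: "nat \<Rightarrow> (real Matrix.vec \<Rightarrow> real Matrix.vec) \<Rightarrow> bool" where
  "nonsingular n F \<longleftrightarrow> (\<forall>x\<in>carrier_vec n. jacobian_det n F x \<noteq> 0)"

definition fiber :: "nat \<Rightarrow> (real Matrix.vec \<Rightarrow> real Matrix.vec) \<Rightarrow> real Matrix.vec \<Rightarrow> real Matrix.vec set" where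
  "fiber n F y = {x \<in> carrier_vec n. F x = y}"

definition fibers_at_most :: "nat \<Rightarrow> (real Matrix.vec \<Rightarrow> real Matrix.vec) \<Rightarrow> nat \<Rightarrow> bool" where
  "fibers_at_most n F b \<longleftrightarrow> (\<forall>y\<in>carrier_vec n. finite (fiber n F y) \<and> card (fiber n F y) \<le> b)"

section \<open>Algorithms over the reals\<close>

text \<open>
  The coefficients are arbitrary reals, so algorithms are understood in the sense of Blum, Shub and
  Smale: real numbers are atomic data, on which field operations and comparison are exact elementary
  steps. The model is a while language on finite binary trees with real leaves, with 0 and 1 as
  the only built-in numbers. As usual, pairs and \<open>Null\<close> serve to write lists, and every
  value other than \<open>Null\<close> counts as true.
\<close>

datatype data = Null | Num real | Pair data data

datatype prog =
    Skip
  | MkNull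
  | Zero
  | One
  | First
  | Second
  | Add
  | Subtract
  | Multiply
  | Divide
  | Less
  | Seq prog prog
  | Both prog prog
  | Cond prog prog prog
  | While prog prog

text \<open>
  \<open>exec p x y\<close>: on input \<open>x\<close> the program \<open>p\<close> halts with output \<open>y\<close>. An ill-typed operation and a division
  by zero have no result.
\<close>

inductive exec :: "prog \<Rightarrow> data \<Rightarrow> data \<Rightarrow> bool" where
  Skip: "exec Skip x x"
| MkNull: "exec MkNull x Null"
| Zero: "exec Zero x (Num 0)"
| One: "exec One x (Num 1)"
| First: "exec First (Pair x y) x"
| Second: "exec Second (Pair x y) y"
| Add: "exec Add (Pair (Num a) (Num b)) (Num (a + b))"
| Subtract: "exec Subtract (Pair (Num a) (Num b)) (Num (a - b))"
| Multiply: "exec Multiply (Pair (Num a) (Num b)) (Num (a * b))"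
| Divide: "b \<noteq> 0 \<Longrightarrow> exec Divide (Pair (Num a) (Num b)) (Num (a / b))"
| Less: "exec Less (Pair (Num a) (Num b)) (if a < b then Num 1 else Null)"
| Seq: "exec p x y \<Longrightarrow> exec q y z \<Longrightarrow> exec (Seq p q) x z"
| Both: "exec p x y \<Longrightarrow> exec q x z \<Longrightarrow> exec (Both p q) x (Pair y z)"
| CondTrue: "exec t x u \<Longrightarrow> u \<noteq> Null \<Longrightarrow> exec p x y \<Longrightarrow> exec (Cond t p q) x y"
| CondFalse: "exec t x Null \<Longrightarrow> exec q x y \<Longrightarrow> exec (Cond t p q) x y"
| WhileTrue: "exec t x u \<Longrightarrow> u \<noteq> Null \<Longrightarrow> exec p x y \<Longrightarrow> exec (While t p) y z \<Longrightarrow> exec (While t p) x z"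
| WhileFalse: "exec t x Null \<Longrightarrow> exec (While t p) x x"

inductive_cases exec_basicE:
  "exec Skip x y" "exec MkNull x y" "exec Zero x y" "exec One x y" "exec First x y" "exec Second x y"
  "exec Add x y" "exec Subtract x y" "exec Multiply x y" "exec Divide x y" "exec Less x y"
inductive_cases exec_SeqE: "exec (Seq p q) x y"
inductive_cases exec_BothE: "exec (Both p q) x y"
inductive_cases exec_CondE: "exec (Cond t p q) x y"
inductive_cases exec_WhileE: "exec (While t p) x y"

lemma exec_deterministic: "exec p x y \<Longrightarrow> exec p x y' \<Longrightarrow> y' = y"
proof (induction arbitrary: y' rule: exec.induct)
  case (Seq p x y q z)
  from Seq.prems show ?case by (rule exec_SeqE) (use Seq.IH in blast)
next
  case (Both p x y q z)
  from Both.prems show ?case by (rule exec_BothE) (use Both.IH in blast)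
next
  case (CondTrue t x u p y q)
  from CondTrue.prems show ?case by (rule exec_CondE) (use CondTrue.IH CondTrue.hyps in blast)+
next
  case (CondFalse t x q y p)
  from CondFalse.prems show ?case by (rule exec_CondE) (use CondFalse.IH in blast)+
next
  case (WhileTrue t x u p y z)
  from WhileTrue.prems show ?case by (rule exec_WhileE) (use WhileTrue.IH WhileTrue.hyps in blast)+
next
  case (WhileFalse t x p)
  from WhileFalse.prems show ?case by (rule exec_WhileE) (use WhileFalse.IH in blast)+
qed (auto elim: exec_basicE)

primrec data_of_list :: "('a \<Rightarrow> data) \<Rightarrow> 'a list \<Rightarrow> data" where
  "data_of_list f [] = Null"
| "data_of_list f (x # xs) = Pair (f x) (data_of_list f xs)"

text \<open>The dimension is not encoded separately, being the number of components.\<close>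

definition data_of_map :: "terms list \<Rightarrow> data" where
  "data_of_map =
     data_of_list (data_of_list (\<lambda>(c, ks). Pair (Num c) (data_of_list (\<lambda>k. Num (real k)) ks)))"

end

theory Submission
  imports Defs "HOL-Library.While_Combinator"
begin

text \<open>
  The algorithm searches the points of \<open>\<nat>\<^sup>n\<close> for one where the Jacobian matrix is invertible; a nonzero
  polynomial cannot vanish at all of them. After moving that point to the origin, Gram-Schmidt
  orthogonalisation of the linear parts (which over the reals needs no pivoting) turns \<open>F\<close>, up to affine
  automorphisms, into \<open>X + F\<^sub>2 + \<cdots> + F\<^sub>d\<close> with \<open>F\<^sub>k\<close> homogeneous of degree \<open>k\<close>. Passing to
  \<open>(X + t F\<^sub>2 + \<cdots> + t\<^bsup>d-1\<^esup> F\<^sub>d, t)\<close> changes neither nonsingularity nor the bounds on fibers, since for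
  \<open>t \<noteq> 0\<close> this is a rescaled copy of \<open>F\<close> and for \<open>t = 0\<close> it is the identity.

  The terms are then made cubic one by one, each time composing with elementary polynomial
  automorphisms on both sides after adding variables. A product \<open>t A B\<close> in component \<open>i\<close> is traded for
  \<open>- t y z + t y B + t z A\<close> together with new components \<open>y - A\<close> and \<open>z - B\<close>, because
  \<open>t (y - A) (z - B)\<close> is a polynomial in the other components of the image; likewise \<open>t\<^sup>2 A\<close> is traded for
  \<open>t\<^sup>2 y\<close> and a new component \<open>y - A\<close>.

  All maps act on \<open>nat \<Rightarrow> real\<close>, as the identity on all but finitely many coordinates, so that adding
  variables requires no change of the space. Nonsingularity is expressed by curves: a map is
  unramified if a curve is stationary at 0 as soon as its image is.
\<close>

section \<open>Computable functions\<close>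

text \<open>\<open>z\<close> plays the part of an environment: every variable in scope is read off
  from it. The encodings are parameters, so that the rules apply to open terms in any
  environment.\<close>

definition computable :: "('a \<Rightarrow> data) \<Rightarrow> ('b \<Rightarrow> data) \<Rightarrow> ('a \<Rightarrow> 'b) \<Rightarrow> bool" where
  "computable e e' f \<longleftrightarrow> (\<exists>p. \<forall>x. exec p (e x) (e' (f x)))"

definition nat_code :: "nat \<Rightarrow> data" where "nat_code k = Num (real k)"
definition bool_code :: "bool \<Rightarrow> data" where "bool_code b = (if b then Num 1 else Null)"
definition pair_code :: "('a \<Rightarrow> data) \<Rightarrow> ('b \<Rightarrow> data) \<Rightarrow> 'a \<times> 'b \<Rightarrow> data" where
  "pair_code e e' z = Pair (e (fst z)) (e' (snd z))"

abbreviation "real_code \<equiv> Num"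
abbreviation "list_code \<equiv> data_of_list"
abbreviation "term_code \<equiv> pair_code real_code (list_code nat_code)"
abbreviation "poly_code \<equiv> list_code term_code"

lemma data_of_map_code: "data_of_map = list_code poly_code"
proof -
  have 1: "(\<lambda>(c, ks). Pair (Num c) (data_of_list (\<lambda>k. Num (real k)) ks)) = term_code"
    by (auto simp: fun_eq_iff pair_code_def nat_code_def[abs_def])
  show ?thesis unfolding data_of_map_def 1 ..
qed

named_theorems computable_intros

lemma computable_id [computable_intros]: "computable e e (\<lambda>z. z)"
  unfolding computable_def using exec.Skip by blast

text \<open>Kept out of \<open>computable_intros\<close>, as its conclusion would match every goal.
  Resolved with an assumption by \<open>THEN\<close>, it carries that assumption to a larger
  environment, for instance under the binder of a \<open>map\<close>.\<close>

lemma computable_compose: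
  "computable e' e'' f \<Longrightarrow> computable e e' g \<Longrightarrow> computable e e'' (\<lambda>z. f (g z))"
  unfolding computable_def by (meson exec.Seq)

lemma computable_Pair [computable_intros]:
  "computable e e1 f \<Longrightarrow> computable e e2 g \<Longrightarrow> computable e (pair_code e1 e2) (\<lambda>z. (f z, g z))"
  unfolding computable_def pair_code_def by (auto intro: exec.Both)

lemma computable_fst [computable_intros]:
  "computable e (pair_code e1 e2) f \<Longrightarrow> computable e e1 (\<lambda>z. fst (f z))"
  unfolding computable_def pair_code_def by (meson exec.Seq exec.First)

lemma computable_snd [computable_intros]:
  "computable e (pair_code e1 e2) f \<Longrightarrow> computable e e2 (\<lambda>z. snd (f z))"
  unfolding computable_def pair_code_def by (meson exec.Seq exec.Second)

lemma computable_real_0 [computable_intros]: "computable e real_code (\<lambda>z. 0)"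
  unfolding computable_def by (meson exec.Zero)

lemma computable_real_1 [computable_intros]: "computable e real_code (\<lambda>z. 1)"
  unfolding computable_def by (meson exec.One)

lemma computable_real_add [computable_intros]:
  "computable e real_code f \<Longrightarrow> computable e real_code g \<Longrightarrow> computable e real_code (\<lambda>z. f z + g z)"
  unfolding computable_def by (meson exec.Seq exec.Both exec.Add)

lemma computable_real_diff [computable_intros]:
  "computable e real_code f \<Longrightarrow> computable e real_code g \<Longrightarrow> computable e real_code (\<lambda>z. f z - g z)"
  unfolding computable_def by (meson exec.Seq exec.Both exec.Subtract)

lemma computable_real_mult [computable_intros]:
  "computable e real_code f \<Longrightarrow> computable e real_code g \<Longrightarrow> computable e real_code (\<lambda>z. f z * g z)"
  unfolding computable_def by (meson exec.Seq exec.Both exec.Multiply)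

lemma computable_real_uminus [computable_intros]:
  "computable e real_code f \<Longrightarrow> computable e real_code (\<lambda>z. - f z)"
  using computable_real_diff[OF computable_real_0, of e f] by simp

lemma computable_real_less [computable_intros]:
  "computable e real_code f \<Longrightarrow> computable e real_code g \<Longrightarrow> computable e bool_code (\<lambda>z. f z < g z)"
  unfolding computable_def bool_code_def by (meson exec.Seq exec.Both exec.Less)

lemma computable_True [computable_intros]: "computable e bool_code (\<lambda>z. True)"
  unfolding computable_def bool_code_def by (auto intro: exec.One)

lemma computable_False [computable_intros]: "computable e bool_code (\<lambda>z. False)"
  unfolding computable_def bool_code_def by (auto intro: exec.MkNull)

lemma computable_if [computable_intros]:
  assumes "computable e bool_code b" "computable e e' f" "computable e e' g"
  shows "computable e e' (\<lambda>z. if b z then f z else g z)"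
proof -
  obtain t p q where t: "\<And>x. exec t (e x) (bool_code (b x))"
    and p: "\<And>x. exec p (e x) (e' (f x))" and q: "\<And>x. exec q (e x) (e' (g x))"
    using assms unfolding computable_def by metis
  have "exec (Cond t p q) (e x) (e' (if b x then f x else g x))" for x
    using t[of x] p[of x] q[of x]
    by (cases "b x") (auto simp: bool_code_def intro: exec.CondTrue exec.CondFalse)
  then show ?thesis unfolding computable_def by blast
qed

lemma computable_not [computable_intros]:
  "computable e bool_code b \<Longrightarrow> computable e bool_code (\<lambda>z. \<not> b z)"
  using computable_if[OF _ computable_False computable_True, of e b] by (simp add: if_bool_eq_conj)

lemma computable_conj [computable_intros]:
  "computable e bool_code a \<Longrightarrow> computable e bool_code b \<Longrightarrow> computable e bool_code (\<lambda>z. a z \<and> b z)"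
  using computable_if[OF _ _ computable_False, of e a b]
  by (simp add: if_bool_eq_conj conj_commute cong: conj_cong)

text \<open>In HOL \<open>a / 0 = 0\<close>, whereas \<open>Divide\<close> has no result there, so a
  zero divisor is caught first. Equality with 0 is tested by two comparisons.\<close>

lemma computable_real_divide [computable_intros]:
  assumes "computable e real_code f" "computable e real_code g"
  shows "computable e real_code (\<lambda>z. f z / g z)"
proof -
  have "computable e bool_code (\<lambda>z. \<not> g z < 0 \<and> \<not> 0 < g z)"
    by ((rule assms[THEN computable_compose] assms computable_intros)+)
  then obtain t p q where t: "\<And>x. exec t (e x) (bool_code (\<not> g x < 0 \<and> \<not> 0 < g x))"
    and p: "\<And>x. exec p (e x) (Num (f x))" and q: "\<And>x. exec q (e x) (Num (g x))"
    using assms unfolding computable_def by metis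
  have "exec (Cond t Zero (Seq (Both p q) Divide)) (e x) (Num (f x / g x))" for x
  proof (cases "g x = 0")
    case True
    then have "exec t (e x) (Num 1)" using t[of x] by (simp add: bool_code_def)
    then show ?thesis using True exec.CondTrue[OF _ _ exec.Zero] by fastforce
  next
    case False
    then have "exec t (e x) Null" using t[of x] by (auto simp: bool_code_def split: if_splits)
    moreover have "exec (Seq (Both p q) Divide) (e x) (Num (f x / g x))"
      using False by (intro exec.Seq[OF exec.Both[OF p q]] exec.Divide)
    ultimately show ?thesis by (rule exec.CondFalse)
  qed
  then show ?thesis unfolding computable_def by blast
qed

lemma computable_real_of_nat:
  "computable e real_code (\<lambda>z. real (f z)) \<longleftrightarrow> computable e nat_code f"
  by (simp add: computable_def nat_code_def)

lemma computable_nat_0 [computable_intros]: "computable e nat_code (\<lambda>z. 0)"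
  using computable_real_0 by (simp flip: computable_real_of_nat)

lemma computable_nat_1 [computable_intros]: "computable e nat_code (\<lambda>z. 1)"
  using computable_real_1 by (simp flip: computable_real_of_nat)

lemma computable_nat_add [computable_intros]:
  "computable e nat_code f \<Longrightarrow> computable e nat_code g \<Longrightarrow> computable e nat_code (\<lambda>z. f z + g z)"
  using computable_real_add by (simp flip: computable_real_of_nat)

lemma computable_nat_less [computable_intros]:
  "computable e nat_code f \<Longrightarrow> computable e nat_code g \<Longrightarrow> computable e bool_code (\<lambda>z. f z < g z)"
  using computable_real_less[of e "\<lambda>z. real (f z)" "\<lambda>z. real (g z)"]
  by (simp add: computable_real_of_nat)

text \<open>Subtraction of naturals truncates at 0, that of their real codes does not.\<close>

lemma computable_nat_diff [computable_intros]:
  assumes "computable e nat_code f" "computable e nat_code g"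
  shows "computable e nat_code (\<lambda>z. f z - g z)"
proof -
  have "computable e real_code (\<lambda>z. if f z < g z then 0 else real (f z) - real (g z))"
    by ((rule assms[folded computable_real_of_nat] assms computable_intros)+)
  moreover have "(if f z < g z then 0 else real (f z) - real (g z)) = real (f z - g z)" for z
    by simp
  ultimately show ?thesis by (simp flip: computable_real_of_nat)
qed

lemma computable_nat_eq [computable_intros]:
  assumes "computable e nat_code f" "computable e nat_code g"
  shows "computable e bool_code (\<lambda>z. f z = g z)"
proof -
  have "computable e bool_code (\<lambda>z. \<not> f z < g z \<and> \<not> g z < f z)"
    by ((rule assms[THEN computable_compose] assms computable_intros)+)
  moreover have "(\<not> f z < g z \<and> \<not> g z < f z) = (f z = g z)" for z by auto
  ultimately show ?thesis by simp
qed

lemma computable_Nil [computable_intros]: "computable e (list_code e') (\<lambda>z. [])"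
  unfolding computable_def by (auto intro: exec.MkNull)

lemma computable_Cons [computable_intros]:
  "computable e e' f \<Longrightarrow> computable e (list_code e') g \<Longrightarrow> computable e (list_code e') (\<lambda>z. f z # g z)"
  unfolding computable_def by (auto intro: exec.Both)

text \<open>The code of a list serves as its own test, since only \<open>Null\<close> counts as
  false. The code of \<open>y # ys\<close> is already that of the pair \<open>(y, ys)\<close>, by
  which the environment of the second branch is extended.\<close>

lemma computable_case_list [computable_intros]:
  assumes "computable e (list_code e1) l" "computable e e' f"
    and "computable (pair_code e (pair_code e1 (list_code e1))) e'
           (\<lambda>z. g (fst z) (fst (snd z)) (snd (snd z)))"
  shows "computable e e' (\<lambda>z. case_list (f z) (g z) (l z))"
proof -
  obtain t p q where t: "\<And>x. exec t (e x) (list_code e1 (l x))"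
    and p: "\<And>x. exec p (e x) (e' (f x))"
    and q: "\<And>x. exec q (pair_code e (pair_code e1 (list_code e1)) x) (e' (g (fst x) (fst (snd x)) (snd (snd x))))"
    using assms unfolding computable_def by metis
  have "exec (Cond t (Seq (Both Skip t) q) p) (e x) (e' (case_list (f x) (g x) (l x)))" for x
  proof (cases "l x")
    case Nil
    then show ?thesis using t[of x] p[of x] by (auto intro: exec.CondFalse)
  next
    case (Cons y ys)
    have "exec (Both Skip t) (e x) (pair_code e (pair_code e1 (list_code e1)) (x, y, ys))"
      using t[of x] Cons by (auto simp: pair_code_def intro: exec.Both exec.Skip)
    then have "exec (Seq (Both Skip t) q) (e x) (e' (g x y ys))"
      using q[of "(x, y, ys)"] by (auto intro: exec.Seq)
    then show ?thesis using t[of x] Cons by (auto intro: exec.CondTrue)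
  qed
  then show ?thesis unfolding computable_def by blast
qed

section \<open>Loops and recursion over lists\<close>

lemma exec_While:
  assumes t: "\<And>x. exec t (e x) (bool_code (b x))" and p: "\<And>x. exec p (e x) (e (f x))"
    and "\<not> b ((f ^^ k) x)"
  shows "exec (While t p) (e x) (e (while b f x))"
  using assms(3)
proof (induction k arbitrary: x)
  case 0
  then show ?case using t[of x] by (auto simp: bool_code_def while_unfold intro: exec.WhileFalse)
next
  case (Suc k)
  show ?case
  proof (cases "b x")
    case True
    have "exec (While t p) (e (f x)) (e (while b f (f x)))"
      using Suc by (simp add: funpow_swap1)
    then show ?thesis using True t[of x] p[of x]
      by (subst while_unfold) (auto simp: bool_code_def intro: exec.WhileTrue)
  next
    case False
    then show ?thesis using t[of x] by (auto simp: bool_code_def while_unfold intro: exec.WhileFalse)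
  qed
qed

text \<open>Halting is required from every state because \<open>computable\<close> speaks of total
  functions. The search for a regular point has no such guarantee and goes through
  \<open>exec_While\<close> directly.\<close>

lemma computable_while:
  assumes "computable e bool_code b" "computable e e f" "computable e' e g"
    and "\<And>x. \<exists>k. \<not> b ((f ^^ k) x)"
  shows "computable e' e (\<lambda>z. while b f (g z))"
proof -
  obtain t p where "\<And>x. exec t (e x) (bool_code (b x))" "\<And>x. exec p (e x) (e (f x))"
    using assms unfolding computable_def by metis
  then have "computable e e (while b f)"
    using assms(4) exec_While[of t e b p f] unfolding computable_def by metis
  then show ?thesis using assms(3) by (rule computable_compose)
qed

text \<open>The recursion principle from which most other list functions are derived. The loop works
  on the environment, the accumulator and the rest of the list, and stops when the rest is
  \<open>Null\<close>.\<close>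

lemma computable_foldl [computable_intros]:
  assumes "computable e (list_code e1) l" "computable e e' s"
    and "computable (pair_code e (pair_code e' e1)) e' (\<lambda>z. f (fst z) (fst (snd z)) (snd (snd z)))"
  shows "computable e e' (\<lambda>z. foldl (f z) (s z) (l z))"
proof -
  obtain p where p: "\<And>x. exec p (pair_code e (pair_code e' e1) x) (e' (f (fst x) (fst (snd x)) (snd (snd x))))"
    using assms(3) unfolding computable_def by metis
  obtain ps pl where ps: "\<And>x. exec ps (e x) (e' (s x))" and pl: "\<And>x. exec pl (e x) (list_code e1 (l x))"
    using assms(1,2) unfolding computable_def by metis
  \<comment> \<open>The environment is kept, the accumulator is updated with the head of the list,
    and the head is dropped.\<close>
  let ?p = "Both First (Both
    (Seq (Both First (Both (Seq Second First) (Seq Second (Seq Second First)))) p)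
    (Seq Second (Seq Second Second)))"
  have step: "exec ?p (Pair (e x) (Pair (e' r) (Pair (e1 y) ys))) (Pair (e x) (Pair (e' (f x r y)) ys))"
    for x r y ys
  proof -
    have "exec (Both First (Both (Seq Second First) (Seq Second (Seq Second First))))
      (Pair (e x) (Pair (e' r) (Pair (e1 y) ys))) (pair_code e (pair_code e' e1) (x, r, y))"
      by (auto simp: pair_code_def intro!: exec.intros)
    then have "exec (Seq (Both First (Both (Seq Second First) (Seq Second (Seq Second First)))) p)
      (Pair (e x) (Pair (e' r) (Pair (e1 y) ys))) (e' (f x r y))"
      using p[of "(x, r, y)"] by (auto intro: exec.Seq)
    then show ?thesis by (meson exec.First exec.Second exec.Seq exec.Both)
  qed
  have loop: "exec (While (Seq Second Second) ?p) (Pair (e x) (Pair (e' r) (list_code e1 ys)))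
      (Pair (e x) (Pair (e' (foldl (f x) r ys)) Null))" for x r ys
  proof (induction ys arbitrary: r)
    case Nil
    have "exec (Seq Second Second) (Pair (e x) (Pair (e' r) (list_code e1 []))) Null"
      by (auto intro: exec.intros)
    then show ?case by (simp add: exec.WhileFalse)
  next
    case (Cons y ys)
    have "exec (Seq Second Second) (Pair (e x) (Pair (e' r) (list_code e1 (y # ys))))
        (Pair (e1 y) (list_code e1 ys))"
      by (auto intro: exec.intros)
    then show ?case using step[of x r y "list_code e1 ys"] Cons.IH[of "f x r y"]
      by (auto intro: exec.WhileTrue)
  qed
  have "exec (Seq (Both Skip (Both ps pl)) (Seq (While (Seq Second Second) ?p) (Seq Second First)))
      (e x) (e' (foldl (f x) (s x) (l x)))" for x
    by (rule exec.Seq, rule exec.Both, rule exec.Skip, rule exec.Both, rule ps, rule pl,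
        rule exec.Seq, rule loop, rule exec.Seq, rule exec.Second, rule exec.First)
  then show ?thesis unfolding computable_def by blast
qed

lemma foldl_Cons_conv: "foldl (\<lambda>xs x. f x # xs) ys xs = rev (map f xs) @ ys"
  by (induction xs arbitrary: ys) auto

lemma computable_rev [computable_intros]:
  assumes "computable e (list_code e1) l"
  shows "computable e (list_code e1) (\<lambda>z. rev (l z))"
proof -
  have "computable e (list_code e1) (\<lambda>z. foldl (\<lambda>xs x. x # xs) [] (l z))"
    by ((rule assms[THEN computable_compose] assms computable_intros)+)
  then show ?thesis by (simp add: foldl_Cons_conv[of "\<lambda>x. x", simplified])
qed

lemma computable_map [computable_intros]:
  assumes "computable e (list_code e1) l"
    and "computable (pair_code e e1) e2 (\<lambda>z. f (fst z) (snd z))"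
  shows "computable e (list_code e2) (\<lambda>z. map (f z) (l z))"
proof -
  have "computable (pair_code e (pair_code (list_code e2) e1)) e2 (\<lambda>z. f (fst z) (snd (snd z)))"
    using computable_compose[OF assms(2), of "pair_code e (pair_code (list_code e2) e1)" "\<lambda>z. (fst z, snd (snd z))",
        OF computable_Pair[OF computable_fst[OF computable_id] computable_snd[OF computable_snd[OF computable_id]]]]
    by simp
  note f = this
  have "computable e (list_code e2) (\<lambda>z. rev (foldl (\<lambda>xs x. f z x # xs) [] (l z)))"
    by ((rule f assms(1) computable_intros)+)
  then show ?thesis by (simp add: foldl_Cons_conv)
qed

lemma computable_append [computable_intros]:
  assumes "computable e (list_code e1) l" "computable e (list_code e1) l'"
  shows "computable e (list_code e1) (\<lambda>z. l z @ l' z)"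
proof -
  have "computable e (list_code e1) (\<lambda>z. foldl (\<lambda>xs x. x # xs) (l' z) (rev (l z)))"
    by ((rule assms[THEN computable_compose] assms computable_intros)+)
  then show ?thesis by (simp add: foldl_Cons_conv[of "\<lambda>x. x", simplified])
qed

lemma computable_concat [computable_intros]:
  assumes "computable e (list_code (list_code e1)) l"
  shows "computable e (list_code e1) (\<lambda>z. concat (l z))"
proof -
  have "computable e (list_code e1) (\<lambda>z. foldl (\<lambda>xs x. xs @ x) [] (l z))"
    by ((rule assms[THEN computable_compose] assms computable_intros)+)
  moreover have "foldl (\<lambda>xs x. xs @ x) ys xs = ys @ concat xs" for ys and xs :: "'b list list"
    by (induction xs arbitrary: ys) auto
  ultimately show ?thesis by simp
qed

lemma computable_filter [computable_intros]:
  assumes "computable e (list_code e1) l"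
    and "computable (pair_code e e1) bool_code (\<lambda>z. f (fst z) (snd z))"
  shows "computable e (list_code e1) (\<lambda>z. filter (f z) (l z))"
proof -
  have "computable e (list_code e1) (\<lambda>z. concat (map (\<lambda>x. if f z x then [x] else []) (l z)))"
    by ((rule assms[THEN computable_compose] assms computable_intros)+)
  moreover have "concat (map (\<lambda>x. if P x then [x] else []) xs) = filter P xs" for P and xs :: "'b list"
    by (induction xs) auto
  ultimately show ?thesis by simp
qed

lemma computable_sum_list [computable_intros]:
  assumes "computable e (list_code real_code) l"
  shows "computable e real_code (\<lambda>z. sum_list (l z))"
proof -
  have "computable e real_code (\<lambda>z. foldl (\<lambda>x y. x + y) 0 (l z))"
    by ((rule assms[THEN computable_compose] assms computable_intros)+)
  then show ?thesis by (simp add: fold_plus_sum_list_rev foldl_conv_fold add.commute)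
qed

lemma computable_list_all [computable_intros]:
  assumes "computable e (list_code e1) l"
    and "computable (pair_code e e1) bool_code (\<lambda>z. f (fst z) (snd z))"
  shows "computable e bool_code (\<lambda>z. list_all (f z) (l z))"
proof -
  have "computable e bool_code (\<lambda>z. case filter (\<lambda>x. \<not> f z x) (l z) of [] \<Rightarrow> True | y # ys \<Rightarrow> False)"
    by ((rule assms[THEN computable_compose] assms computable_intros)+)
  moreover have "(case filter (\<lambda>x. \<not> P x) xs of [] \<Rightarrow> True | y # ys \<Rightarrow> False) = list_all P xs"
    for P and xs :: "'b list"
    by (induction xs) auto
  ultimately show ?thesis by simp
qed

lemma computable_length [computable_intros]:
  assumes "computable e (list_code e1) l"
  shows "computable e nat_code (\<lambda>z. length (l z))"
proof -
  have "computable e nat_code (\<lambda>z. foldl (\<lambda>k x. k + 1) 0 (l z))"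
    by ((rule assms[THEN computable_compose] assms computable_intros)+)
  moreover have "foldl (\<lambda>k x. k + 1) m xs = m + length xs" for m and xs :: "'b list"
    by (induction xs arbitrary: m) auto
  ultimately show ?thesis by simp
qed

lemma computable_upt [computable_intros]:
  assumes "computable e nat_code n"
  shows "computable e (list_code nat_code) (\<lambda>z. [0..<n z])"
proof -
  \<comment> \<open>Counting down and prepending yields the indices in increasing order.\<close>
  let ?b = "\<lambda>z :: nat \<times> nat list. 0 < fst z" and ?f = "\<lambda>z. (fst z - 1, (fst z - 1) # snd z)"
  have halt: "(?f ^^ k) (k, r) = (0, [0..<k] @ r)" for k r
  proof (induction k arbitrary: r)
    case (Suc k)
    have "(?f ^^ Suc k) (Suc k, r) = (?f ^^ k) (k, k # r)" by (simp only: funpow_Suc_right) simp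
    then show ?case by (simp only: Suc) simp
  qed simp
  have loop: "while ?b ?f (k, r) = (0, [0..<k] @ r)" for k r
  proof (induction k arbitrary: r)
    case (Suc k)
    have "while ?b ?f (Suc k, r) = while ?b ?f (k, k # r)" by (subst while_unfold) simp
    then show ?case by (simp only: Suc) simp
  qed (subst while_unfold, simp)
  have "computable e (pair_code nat_code (list_code nat_code)) (\<lambda>z. while ?b ?f (n z, []))"
  proof (rule computable_while)
    show "\<exists>k. \<not> ?b ((?f ^^ k) x)" for x
      by (rule exI[of _ "fst x"]) (simp only: halt[of "fst x" "snd x", unfolded prod.collapse] fst_conv less_irrefl not_False_eq_True)
  qed (rule assms[THEN computable_compose] assms computable_intros)+
  from computable_snd[OF this] show ?thesis by (simp only: loop snd_conv append_Nil2)
qed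

section \<open>The algorithm\<close>

type_synonym sparse = "(nat \<times> real \<times> nat list) list"

text \<open>A linear functional on polynomials, given by its values on monomials. Evaluation at a
  point and the linear coefficients are both of this form, so relations between polynomials are
  proved once for all \<open>w\<close>.\<close>

definition weigh :: "(nat list \<Rightarrow> real) \<Rightarrow> terms \<Rightarrow> real" where
  "weigh w p = (\<Sum>t\<leftarrow>p. fst t * w (snd t))"

text \<open>The functional that reads off the coefficient of \<open>x_j\<close>. Nested cases on one
  constructor at a time are the form covered by \<open>computable_case_list\<close>.\<close>

definition lin_weight :: "nat \<Rightarrow> nat list \<Rightarrow> real" where
  "lin_weight j ks = (case ks of [] \<Rightarrow> 0 | k # r \<Rightarrow> (case r of [] \<Rightarrow> if k = j then 1 else 0 | h # r' \<Rightarrow> 0))"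

definition lin :: "nat \<Rightarrow> terms \<Rightarrow> real" where
  "lin j p = weigh (lin_weight j) p"

text \<open>The Euclidean inner product of the gradients at the origin.\<close>

definition lin_inner :: "nat \<Rightarrow> terms \<Rightarrow> terms \<Rightarrow> real" where
  "lin_inner n p q = (\<Sum>j\<leftarrow>[0..<n]. lin j p * lin j q)"

definition scale_terms :: "real \<Rightarrow> terms \<Rightarrow> terms" where
  "scale_terms c p = map (\<lambda>t. (c * fst t, snd t)) p"

text \<open>
  A list of indices encodes the point whose \<open>k\<close>-th coordinate is the number of occurrences of \<open>k\<close>, so
  the lists of length \<open>N\<close> enumerate the points of \<open>\<nat>\<^sup>n\<close> with coordinate sum \<open>N\<close>.
\<close>

definition count_point :: "nat list \<Rightarrow> nat \<Rightarrow> real" where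
  "count_point as k = (\<Sum>j\<leftarrow>as. if j = k then 1 else 0)"

text \<open>Multiplication of \<open>p\<close> by the polynomial \<open>a k + x_k\<close>, term by
  term.\<close>

definition shift_step :: "(nat \<Rightarrow> real) \<Rightarrow> nat \<Rightarrow> terms \<Rightarrow> terms" where
  "shift_step a k p = concat (map (\<lambda>t. [(fst t * a k, snd t), (fst t, k # snd t)]) p)"

text \<open>The polynomial \<open>p (a + x)\<close>: each monomial is multiplied out from its
  shifted factors.\<close>

definition shift :: "(nat \<Rightarrow> real) \<Rightarrow> terms \<Rightarrow> terms" where
  "shift a p = concat (map (\<lambda>t. foldl (\<lambda>q k. shift_step a k q) [(fst t, [])] (snd t)) p)"

text \<open>Lengths are not normalised, so no square roots occur. Whole polynomials are combined,
  appending being their sum, while the factors depend only on the linear parts. As division by 0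
  gives 0, a \<open>q\<close> of length 0 contributes nothing.\<close>

definition gram_schmidt_step :: "nat \<Rightarrow> terms list \<Rightarrow> terms \<Rightarrow> terms" where
  "gram_schmidt_step n qs r = r @ concat (map (\<lambda>q. scale_terms (- (lin_inner n r q / lin_inner n q q)) q) qs)"

definition gram_schmidt :: "nat \<Rightarrow> terms list \<Rightarrow> terms list" where
  "gram_schmidt n rs = foldl (\<lambda>qs r. qs @ [gram_schmidt_step n qs r]) [] rs"

text \<open>Positive squared lengths after orthogonalisation replace the evaluation of a
  determinant.\<close>

definition lin_independent :: "nat \<Rightarrow> terms list \<Rightarrow> bool" where
  "lin_independent n rs = list_all (\<lambda>q. 0 < lin_inner n q q) (gram_schmidt n rs)"

text \<open>The orthogonalised linear parts are the rows of a matrix whose inverse is its transpose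
  with each column divided by a squared length. Row \<open>i\<close> of this inverse gives the
  combination with linear part \<open>x_i\<close>.\<close>

definition normalise :: "nat \<Rightarrow> terms list \<Rightarrow> nat \<Rightarrow> terms" where
  "normalise n rs i = concat (map (\<lambda>q. scale_terms (lin i q / lin_inner n q q) q) (gram_schmidt n rs))"

text \<open>Constant and linear terms are both dropped: the constants go into a translation of the
  target, and the linear part is \<open>X\<close> after normalisation and is kept implicit.\<close>

definition higher :: "terms \<Rightarrow> terms" where
  "higher p = filter (\<lambda>t. case snd t of [] \<Rightarrow> False | k # r \<Rightarrow> (case r of [] \<Rightarrow> False | h # r' \<Rightarrow> True)) p"

definition sparse_of :: "nat \<Rightarrow> (nat \<Rightarrow> terms) \<Rightarrow> sparse" where
  "sparse_of n p = concat (map (\<lambda>i. map (\<lambda>t. (i, t)) (higher (p i))) [0..<n])"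

text \<open>
  An entry \<open>(i, c, ks)\<close> of the worklist \<open>w\<close> stands for the term \<open>c t\<^bsup>d-1\<^esup> x\<^bsub>ks\<^esub>\<close> of component \<open>i\<close>, where
  \<open>d = length ks\<close>; the entries of \<open>out\<close> are literal. The next fresh variable is \<open>m\<close>.
\<close>

definition reduce :: "nat \<Rightarrow> nat \<Rightarrow> nat \<Rightarrow> real \<Rightarrow> nat list \<Rightarrow> sparse \<Rightarrow> sparse \<Rightarrow> nat \<times> sparse \<times> sparse" where
  "reduce t m i c ks w out = (case ks of [] \<Rightarrow> (m, w, out) | a # k1 \<Rightarrow>
     (case k1 of [] \<Rightarrow> (m, w, out) | b # k2 \<Rightarrow>
     (case k2 of [] \<Rightarrow> (m, w, (i, c, [t, a, b]) # out) | d # k3 \<Rightarrow>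
     (case k3 of [] \<Rightarrow> (m + 1, w, (i, c, [t, t, m]) # (m, - 1, [a, b, d]) # out) | h # k4 \<Rightarrow>
        (m + 1 + 1, (i, c, m # k2) # (m + 1, - 1, k2) # (i, c, [m + 1, a, b]) # w,
         (i, - c, [t, m, m + 1]) # (m, - 1, [t, a, b]) # out)))))"

definition reduce_step :: "nat \<times> nat \<times> sparse \<times> sparse \<Rightarrow> nat \<times> nat \<times> sparse \<times> sparse" where
  "reduce_step s = (fst s, case fst (snd (snd s)) of [] \<Rightarrow> snd s | u # w \<Rightarrow>
     reduce (fst s) (fst (snd s)) (fst u) (fst (snd u)) (snd (snd u)) w (snd (snd (snd s))))"

definition pending :: "nat \<times> nat \<times> sparse \<times> sparse \<Rightarrow> bool" where
  "pending s = (case fst (snd (snd s)) of [] \<Rightarrow> False | u # w \<Rightarrow> True)"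

text \<open>Variable \<open>n\<close> is the homogenising variable \<open>t\<close>, so
  \<open>n + 1\<close> is the first fresh one.\<close>

definition reduction :: "nat \<Rightarrow> sparse \<Rightarrow> nat \<times> nat \<times> sparse \<times> sparse" where
  "reduction n S = while pending reduce_step (n, n + 1, S, [])"

definition dense :: "nat \<Rightarrow> sparse \<Rightarrow> terms list" where
  "dense m S = map (\<lambda>i. (1, [i]) # map (\<lambda>u. snd u) (filter (\<lambda>u. fst u = i) S)) [0..<m]"

definition cubic_form :: "terms list \<Rightarrow> terms list" where
  "cubic_form rs = (let s = reduction (length rs) (sparse_of (length rs) (normalise (length rs) rs))
     in dense (fst (snd s)) (snd (snd (snd s))))"

section \<open>Search for a regular point\<close>

definition regular_at :: "terms list \<Rightarrow> nat list \<Rightarrow> bool" where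
  "regular_at P as = lin_independent (length P) (map (\<lambda>p. shift (count_point as) p) P)"

definition searching :: "terms list \<times> nat list list \<Rightarrow> bool" where
  "searching s = list_all (\<lambda>as. \<not> regular_at (fst s) as) (snd s)"

definition search_step :: "terms list \<times> nat list list \<Rightarrow> terms list \<times> nat list list" where
  "search_step s = (fst s, concat (map (\<lambda>as. map (\<lambda>k. k # as) [0..<length (fst s)]) (snd s)))"

definition finish :: "terms list \<times> nat list list \<Rightarrow> terms list" where
  "finish s = (case filter (\<lambda>as. regular_at (fst s) as) (snd s) of [] \<Rightarrow> []
     | as # r \<Rightarrow> cubic_form (map (\<lambda>p. shift (count_point as) p) (fst s)))"

section \<open>Computability of the single steps\<close>

abbreviation "sparse_code \<equiv> list_code (pair_code nat_code term_code)"

lemma computable_weigh [computable_intros]: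
  assumes "computable e poly_code p"
    and "computable (pair_code e (list_code nat_code)) real_code (\<lambda>z. w (fst z) (snd z))"
  shows "computable e real_code (\<lambda>z. weigh (w z) (p z))"
proof -
  have w: "computable (pair_code e term_code) real_code (\<lambda>z. w (fst z) (snd (snd z)))"
    using computable_compose[OF assms(2), of "pair_code e term_code" "\<lambda>z. (fst z, snd (snd z))"]
      computable_Pair[OF computable_fst[OF computable_id] computable_snd[OF computable_snd[OF computable_id]]]
    by fastforce
  show ?thesis unfolding weigh_def by ((rule w assms(1) computable_intros)+)
qed

lemma computable_lin_weight [computable_intros]:
  assumes "computable e nat_code j" "computable e (list_code nat_code) ks"
  shows "computable e real_code (\<lambda>z. lin_weight (j z) (ks z))"
  unfolding lin_weight_def by ((rule assms[THEN computable_compose] assms computable_intros)+)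

lemma computable_lin [computable_intros]:
  assumes "computable e nat_code j" "computable e poly_code p"
  shows "computable e real_code (\<lambda>z. lin (j z) (p z))"
  unfolding lin_def by ((rule assms[THEN computable_compose] assms computable_intros)+)

lemma computable_lin_inner [computable_intros]:
  assumes "computable e nat_code n" "computable e poly_code p" "computable e poly_code q"
  shows "computable e real_code (\<lambda>z. lin_inner (n z) (p z) (q z))"
  unfolding lin_inner_def by ((rule assms[THEN computable_compose] assms computable_intros)+)

lemma computable_scale_terms [computable_intros]:
  assumes "computable e real_code c" "computable e poly_code p"
  shows "computable e poly_code (\<lambda>z. scale_terms (c z) (p z))"
  unfolding scale_terms_def by ((rule assms[THEN computable_compose] assms computable_intros)+)

lemma computable_count_point [computable_intros]:
  assumes "computable e (list_code nat_code) as" "computable e nat_code k"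
  shows "computable e real_code (\<lambda>z. count_point (as z) (k z))"
  unfolding count_point_def by ((rule assms[THEN computable_compose] assms computable_intros)+)

lemma computable_shift [computable_intros]:
  assumes "computable e (list_code nat_code) as" "computable e poly_code p"
  shows "computable e poly_code (\<lambda>z. shift (count_point (as z)) (p z))"
  unfolding shift_def shift_step_def by ((rule assms[THEN computable_compose] assms computable_intros)+)

lemma computable_gram_schmidt_step [computable_intros]:
  assumes "computable e nat_code n" "computable e (list_code poly_code) qs" "computable e poly_code r"
  shows "computable e poly_code (\<lambda>z. gram_schmidt_step (n z) (qs z) (r z))"
  unfolding gram_schmidt_step_def by ((rule assms[THEN computable_compose] assms computable_intros)+)

lemma computable_gram_schmidt [computable_intros]:
  assumes "computable e nat_code n" "computable e (list_code poly_code) rs"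
  shows "computable e (list_code poly_code) (\<lambda>z. gram_schmidt (n z) (rs z))"
  unfolding gram_schmidt_def by ((rule assms[THEN computable_compose] assms computable_intros)+)

lemma computable_normalise [computable_intros]:
  assumes "computable e nat_code n" "computable e (list_code poly_code) rs" "computable e nat_code i"
  shows "computable e poly_code (\<lambda>z. normalise (n z) (rs z) (i z))"
  unfolding normalise_def by ((rule assms[THEN computable_compose] assms computable_intros)+)

lemma computable_higher [computable_intros]:
  assumes "computable e poly_code p"
  shows "computable e poly_code (\<lambda>z. higher (p z))"
  unfolding higher_def by ((rule assms[THEN computable_compose] assms computable_intros)+)

lemma computable_sparse_of [computable_intros]:
  assumes "computable e nat_code n"
    and "computable (pair_code e nat_code) poly_code (\<lambda>z. p (fst z) (snd z))"
  shows "computable e sparse_code (\<lambda>z. sparse_of (n z) (p z))"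
  unfolding sparse_of_def by ((rule assms assms(1)[THEN computable_compose] computable_intros)+)

lemma computable_reduce [computable_intros]:
  assumes "computable e nat_code t" "computable e nat_code m" "computable e nat_code i"
    "computable e real_code c" "computable e (list_code nat_code) ks"
    "computable e sparse_code w" "computable e sparse_code out"
  shows "computable e (pair_code nat_code (pair_code sparse_code sparse_code))
    (\<lambda>z. reduce (t z) (m z) (i z) (c z) (ks z) (w z) (out z))"
  unfolding reduce_def by ((rule assms[THEN computable_compose] assms computable_intros)+)

abbreviation "state_code \<equiv> pair_code nat_code (pair_code nat_code (pair_code sparse_code sparse_code))"

lemma computable_reduce_step: "computable state_code state_code reduce_step"
  unfolding reduce_step_def[abs_def] by ((rule computable_intros)+)

lemma computable_pending: "computable state_code bool_code pending"
  unfolding pending_def[abs_def] by ((rule computable_intros)+)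

lemma computable_lin_independent [computable_intros]:
  assumes "computable e nat_code n" "computable e (list_code poly_code) rs"
  shows "computable e bool_code (\<lambda>z. lin_independent (n z) (rs z))"
  unfolding lin_independent_def by ((rule assms[THEN computable_compose] assms computable_intros)+)

lemma computable_dense [computable_intros]:
  assumes "computable e nat_code m" "computable e sparse_code S"
  shows "computable e (list_code poly_code) (\<lambda>z. dense (m z) (S z))"
  unfolding dense_def by ((rule assms[THEN computable_compose] assms computable_intros)+)

lemma computable_regular_at [computable_intros]:
  assumes "computable e (list_code poly_code) P" "computable e (list_code nat_code) as"
  shows "computable e bool_code (\<lambda>z. regular_at (P z) (as z))"
  unfolding regular_at_def by ((rule assms[THEN computable_compose] assms computable_intros)+)

abbreviation "search_code \<equiv> pair_code (list_code poly_code) (list_code (list_code nat_code))"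

lemma computable_searching: "computable search_code bool_code searching"
  unfolding searching_def[abs_def] by ((rule computable_intros)+)

lemma computable_search_step: "computable search_code search_code search_step"
  unfolding search_step_def[abs_def] by ((rule computable_intros)+)

section \<open>Invariance of the fiber type under polynomial automorphisms\<close>

definition curve :: "(real \<Rightarrow> nat \<Rightarrow> real) \<Rightarrow> bool" where
  "curve \<gamma> \<longleftrightarrow> (\<forall>k. \<exists>d. ((\<lambda>s. \<gamma> s k) has_real_derivative d) (at 0))"

definition stationary :: "(real \<Rightarrow> nat \<Rightarrow> real) \<Rightarrow> bool" where
  "stationary \<gamma> \<longleftrightarrow> (\<forall>k. ((\<lambda>s. \<gamma> s k) has_real_derivative 0) (at 0))"

text \<open>The two consequences of the chain rule that the argument rests on. Testing with curves
  avoids derivatives on the infinite-dimensional space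
  \<open>nat \<Rightarrow> real\<close>.\<close>

definition smooth :: "((nat \<Rightarrow> real) \<Rightarrow> real) \<Rightarrow> bool" where
  "smooth f \<longleftrightarrow> (\<forall>\<gamma>. curve \<gamma> \<longrightarrow> (\<exists>d. ((\<lambda>s. f (\<gamma> s)) has_real_derivative d) (at 0))) \<and>
     (\<forall>\<gamma>. stationary \<gamma> \<longrightarrow> ((\<lambda>s. f (\<gamma> s)) has_real_derivative 0) (at 0))"

lemma smooth_const: "smooth (\<lambda>x. c)"
  unfolding smooth_def by (auto intro!: derivative_eq_intros)

lemma smooth_coordinate: "smooth (\<lambda>x. x k)"
  unfolding smooth_def curve_def stationary_def by blast

lemma smooth_add:
  assumes "smooth f" "smooth g"
  shows "smooth (\<lambda>x. f x + g x)"
  unfolding smooth_def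
proof (intro conjI allI impI)
  fix \<gamma> assume "curve \<gamma>"
  then obtain d d' where "((\<lambda>s. f (\<gamma> s)) has_real_derivative d) (at 0)" "((\<lambda>s. g (\<gamma> s)) has_real_derivative d') (at 0)"
    using assms unfolding smooth_def by blast
  from DERIV_add[OF this] show "\<exists>d. ((\<lambda>s. f (\<gamma> s) + g (\<gamma> s)) has_real_derivative d) (at 0)" by blast
next
  fix \<gamma> assume "stationary \<gamma>"
  then have "((\<lambda>s. f (\<gamma> s)) has_real_derivative 0) (at 0)" "((\<lambda>s. g (\<gamma> s)) has_real_derivative 0) (at 0)"
    using assms unfolding smooth_def by blast+
  from DERIV_add[OF this] show "((\<lambda>s. f (\<gamma> s) + g (\<gamma> s)) has_real_derivative 0) (at 0)" by simp
qed

lemma smooth_mult: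
  assumes "smooth f" "smooth g"
  shows "smooth (\<lambda>x. f x * g x)"
  unfolding smooth_def
proof (intro conjI allI impI)
  fix \<gamma> assume "curve \<gamma>"
  then obtain d d' where "((\<lambda>s. f (\<gamma> s)) has_real_derivative d) (at 0)" "((\<lambda>s. g (\<gamma> s)) has_real_derivative d') (at 0)"
    using assms unfolding smooth_def by blast
  from DERIV_mult[OF this] show "\<exists>d. ((\<lambda>s. f (\<gamma> s) * g (\<gamma> s)) has_real_derivative d) (at 0)" by blast
next
  fix \<gamma> assume "stationary \<gamma>"
  then have "((\<lambda>s. f (\<gamma> s)) has_real_derivative 0) (at 0)" "((\<lambda>s. g (\<gamma> s)) has_real_derivative 0) (at 0)"
    using assms unfolding smooth_def by blast+
  from DERIV_mult[OF this] show "((\<lambda>s. f (\<gamma> s) * g (\<gamma> s)) has_real_derivative 0) (at 0)" by simp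
qed

lemma smooth_diff: "smooth f \<Longrightarrow> smooth g \<Longrightarrow> smooth (\<lambda>x. f x - g x)"
  using smooth_add[of f "\<lambda>x. -1 * g x"] smooth_mult[OF smooth_const[of "-1"]] by simp

lemma smooth_uminus: "smooth f \<Longrightarrow> smooth (\<lambda>x. - f x)"
  using smooth_diff[OF smooth_const[of 0], of f] by simp

lemma smooth_if: "smooth f \<Longrightarrow> smooth g \<Longrightarrow> smooth (\<lambda>x. if b then f x else g x)"
  by (cases b) simp_all

lemma smooth_sum:
  "finite A \<Longrightarrow> (\<And>k. k \<in> A \<Longrightarrow> smooth (f k)) \<Longrightarrow> smooth (\<lambda>x. \<Sum>k\<in>A. f k x)"
  by (induction A rule: finite_induct) (auto intro: smooth_const smooth_add)

lemma smooth_sum_list: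
  "(\<And>k. k \<in> set ks \<Longrightarrow> smooth (f k)) \<Longrightarrow> smooth (\<lambda>x. \<Sum>k\<leftarrow>ks. f k x)"
  by (induction ks) (auto intro: smooth_const smooth_add)

definition mon :: "(nat \<Rightarrow> real) \<Rightarrow> nat list \<Rightarrow> real" where
  "mon x ks = (\<Prod>k\<leftarrow>ks. x k)"

lemma mon_simps [simp]:
  "mon x [] = 1" "mon x (k # ks) = x k * mon x ks" "mon x (ks @ ls) = mon x ks * mon x ls"
  "mon x (replicate d k) = x k ^ d"
  by (simp_all add: mon_def)

lemma mon_cong: "(\<And>k. k \<in> set ks \<Longrightarrow> x k = y k) \<Longrightarrow> mon x ks = mon y ks"
  unfolding mon_def by (metis map_eq_conv)

lemma smooth_mon: "smooth (\<lambda>x. mon x ks)"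
  by (induction ks) (auto intro: smooth_const smooth_mult smooth_coordinate)

lemmas smooth_intros = smooth_const smooth_coordinate smooth_add smooth_mult smooth_diff
  smooth_uminus smooth_if smooth_sum smooth_sum_list smooth_mon

definition smooth_map :: "((nat \<Rightarrow> real) \<Rightarrow> nat \<Rightarrow> real) \<Rightarrow> bool" where
  "smooth_map E \<longleftrightarrow> (\<forall>k. smooth (\<lambda>x. E x k))"

lemma smooth_map_curve: "smooth_map E \<Longrightarrow> curve \<gamma> \<Longrightarrow> curve (\<lambda>s. E (\<gamma> s))"
  unfolding smooth_map_def smooth_def curve_def[of "\<lambda>s. E (\<gamma> s)"] by blast

lemma smooth_map_stationary: "smooth_map E \<Longrightarrow> stationary \<gamma> \<Longrightarrow> stationary (\<lambda>s. E (\<gamma> s))"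
  unfolding smooth_map_def smooth_def stationary_def[of "\<lambda>s. E (\<gamma> s)"] by blast

definition inverse_maps :: "((nat \<Rightarrow> real) \<Rightarrow> nat \<Rightarrow> real) \<Rightarrow> ((nat \<Rightarrow> real) \<Rightarrow> nat \<Rightarrow> real) \<Rightarrow> bool" where
  "inverse_maps E E' \<longleftrightarrow> smooth_map E \<and> smooth_map E' \<and> (\<forall>x. E' (E x) = x) \<and> (\<forall>x. E (E' x) = x)"

text \<open>An elementary automorphism: \<open>g\<close> does not see coordinate \<open>i\<close>,
  so what was added can be subtracted again.\<close>

lemma inverse_maps_update:
  assumes g: "\<And>x r. g (x(i := r)) = g x" and "smooth g"
  shows "inverse_maps (\<lambda>x. x(i := x i + g x)) (\<lambda>x. x(i := x i - g x))"
proof -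
  have "smooth (\<lambda>x. (x(i := x i + g x)) k)" "smooth (\<lambda>x. (x(i := x i - g x)) k)" for k
    using smooth_add[OF smooth_coordinate assms(2)] smooth_diff[OF smooth_coordinate assms(2)] smooth_coordinate
    by (cases "k = i"; simp)+
  then show ?thesis unfolding inverse_maps_def smooth_map_def by (simp add: g)
qed

lemma inverse_maps_comp:
  assumes "inverse_maps E E'" "inverse_maps D D'"
  shows "inverse_maps (\<lambda>x. E (D x)) (\<lambda>x. D' (E' x))"
proof -
  have "smooth_map (\<lambda>x. E (D x))" if "smooth_map E" "smooth_map D" for E D
  proof -
    have "smooth (\<lambda>x. E (D x) k)" for k
      unfolding smooth_def
    proof (intro conjI allI impI)
      fix \<gamma> assume "curve \<gamma>"
      then have "curve (\<lambda>s. E (D (\<gamma> s)))" by (intro smooth_map_curve[OF that(1)] smooth_map_curve[OF that(2)])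
      then show "\<exists>d. ((\<lambda>s. E (D (\<gamma> s)) k) has_real_derivative d) (at 0)"
        unfolding curve_def by blast
    next
      fix \<gamma> assume "stationary \<gamma>"
      then have "stationary (\<lambda>s. E (D (\<gamma> s)))" by (intro smooth_map_stationary[OF that(1)] smooth_map_stationary[OF that(2)])
      then show "((\<lambda>s. E (D (\<gamma> s)) k) has_real_derivative 0) (at 0)"
        unfolding stationary_def by blast
    qed
    then show ?thesis unfolding smooth_map_def by blast
  qed
  then have "smooth_map (\<lambda>x. E (D x))" "smooth_map (\<lambda>x. D' (E' x))"
    using assms unfolding inverse_maps_def by blast+
  then show ?thesis using assms unfolding inverse_maps_def by simp
qed

section \<open>Unramified maps and bounds on fibers\<close>

definition unramified :: "((nat \<Rightarrow> real) \<Rightarrow> nat \<Rightarrow> real) \<Rightarrow> bool" where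
  "unramified f \<longleftrightarrow> (\<forall>\<gamma>. curve \<gamma> \<longrightarrow> stationary (\<lambda>s. f (\<gamma> s)) \<longrightarrow> stationary \<gamma>)"

definition fibers_bounded :: "((nat \<Rightarrow> real) \<Rightarrow> nat \<Rightarrow> real) \<Rightarrow> nat \<Rightarrow> bool" where
  "fibers_bounded f b \<longleftrightarrow> (\<forall>y. finite {x. f x = y} \<and> card {x. f x = y} \<le> b)"

definition same_type :: "((nat \<Rightarrow> real) \<Rightarrow> nat \<Rightarrow> real) \<Rightarrow> ((nat \<Rightarrow> real) \<Rightarrow> nat \<Rightarrow> real) \<Rightarrow> bool" where
  "same_type f g \<longleftrightarrow> (unramified f \<longleftrightarrow> unramified g) \<and> (\<forall>b>0. fibers_bounded f b \<longleftrightarrow> fibers_bounded g b)"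

lemma same_type_trans [trans]: "same_type f g \<Longrightarrow> same_type g h \<Longrightarrow> same_type f h"
  unfolding same_type_def by blast

lemma finite_card_le_inj:
  assumes "inj_on h A" "h ` A \<subseteq> B" "finite B \<and> card B \<le> (b :: nat)"
  shows "finite A \<and> card A \<le> b"
  using assms by (meson card_inj_on_le finite_subset inj_on_finite le_trans)

lemma same_type_conjugate:
  assumes "inverse_maps E E'" "inverse_maps D D'" "\<And>x. g x = D (f (E x))"
  shows "same_type f g"
proof -
  \<comment> \<open>One implication suffices, since \<open>f\<close> arises from \<open>g\<close> by
    conjugation with the inverse automorphisms.\<close>
  have *: "(unramified f \<longrightarrow> unramified g) \<and> (fibers_bounded f b \<longrightarrow> fibers_bounded g b)"
    if E: "inverse_maps E E'" and D: "inverse_maps D D'" and g: "\<And>x. g x = D (f (E x))" for E E' D D' f g b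
  proof (intro conjI impI)
    assume f: "unramified f"
    show "unramified g"
      unfolding unramified_def
    proof (intro allI impI)
      fix \<gamma> assume \<gamma>: "curve \<gamma>" "stationary (\<lambda>s. g (\<gamma> s))"
      have "stationary (\<lambda>s. D' (g (\<gamma> s)))"
        using D \<gamma> by (auto simp: inverse_maps_def intro: smooth_map_stationary)
      then have "stationary (\<lambda>s. f (E (\<gamma> s)))" using D by (simp add: g inverse_maps_def)
      then have "stationary (\<lambda>s. E (\<gamma> s))"
        using f E \<gamma> unfolding unramified_def by (simp add: inverse_maps_def smooth_map_curve)
      then have "stationary (\<lambda>s. E' (E (\<gamma> s)))"
        using E smooth_map_stationary[of E' "\<lambda>s. E (\<gamma> s)"] by (auto simp: inverse_maps_def)
      then show "stationary \<gamma>" using E by (simp add: inverse_maps_def)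
    qed
  next
    assume f: "fibers_bounded f b"
    show "fibers_bounded g b"
      unfolding fibers_bounded_def
    proof
      fix y
      show "finite {x. g x = y} \<and> card {x. g x = y} \<le> b"
      proof (rule finite_card_le_inj)
        show "inj_on E {x. g x = y}" using E unfolding inverse_maps_def inj_on_def by metis
        show "E ` {x. g x = y} \<subseteq> {x. f x = D' y}" using D by (auto simp: g inverse_maps_def)
      qed (use f in \<open>simp add: fibers_bounded_def\<close>)
    qed
  qed
  have "inverse_maps E' E" "inverse_maps D' D" "\<And>x. f x = D' (g (E' x))"
    using assms by (auto simp: inverse_maps_def)
  with assms show ?thesis
    using *[of E E' D D' g f] *[of E' E D' D f g] unfolding same_type_def by blast
qed

section \<open>Perturbations of the identity and their homogenisation\<close>

definition sparse_eval :: "sparse \<Rightarrow> (nat \<Rightarrow> real) \<Rightarrow> nat \<Rightarrow> real" where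
  "sparse_eval S x i = (\<Sum>u\<leftarrow>S. if fst u = i then fst (snd u) * mon x (snd (snd u)) else 0)"

definition perturb :: "sparse \<Rightarrow> (nat \<Rightarrow> real) \<Rightarrow> nat \<Rightarrow> real" where
  "perturb S x i = x i + sparse_eval S x i"

lemma sparse_eval_simps [simp]:
  "sparse_eval [] x i = 0"
  "sparse_eval (u # S) x i = (if fst u = i then fst (snd u) * mon x (snd (snd u)) else 0) + sparse_eval S x i"
  "sparse_eval (S @ S') x i = sparse_eval S x i + sparse_eval S' x i"
  by (simp_all add: sparse_eval_def)

definition no_component :: "nat \<Rightarrow> sparse \<Rightarrow> bool" where
  "no_component i S \<longleftrightarrow> (\<forall>u\<in>set S. fst u \<noteq> i)"

definition no_variable :: "nat \<Rightarrow> sparse \<Rightarrow> bool" where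
  "no_variable k S \<longleftrightarrow> (\<forall>u\<in>set S. k \<notin> set (snd (snd u)))"

lemma sparse_eval_no_component: "no_component i S \<Longrightarrow> sparse_eval S x i = 0"
  unfolding no_component_def by (induction S) auto

lemma sparse_eval_no_variable: "no_variable k S \<Longrightarrow> sparse_eval S (x(k := r)) i = sparse_eval S x i"
  unfolding no_variable_def by (induction S) (auto intro!: mon_cong)

definition homogenise :: "nat \<Rightarrow> sparse \<Rightarrow> sparse" where
  "homogenise t S = map (\<lambda>u. (fst u, fst (snd u), replicate (length (snd (snd u)) - 1) t @ snd (snd u))) S"

lemma homogenise_simps [simp]:
  "homogenise t [] = []"
  "homogenise t (u # S) = (fst u, fst (snd u), replicate (length (snd (snd u)) - 1) t @ snd (snd u)) # homogenise t S"
  by (simp_all add: homogenise_def)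

text \<open>
  On the hyperplane \<open>x t = s\<close> the homogenised map is conjugate, by scaling with \<open>s\<close>, to the original map
  if \<open>s \<noteq> 0\<close>, and is the identity if \<open>s = 0\<close>; this is why only bounds \<open>b > 0\<close> are compared.
\<close>

lemma same_type_homogenise:
  assumes t: "no_component t S" "no_variable t S" and S: "\<forall>u\<in>set S. 2 \<le> length (snd (snd u))"
  shows "same_type (perturb S) (perturb (homogenise t S))"
proof -
  define f where "f = perturb S"
  define g where "g = perturb (homogenise t S)"
  \<comment> \<open>Scaling by \<open>x t\<close> of all coordinates but \<open>t\<close>. It
    intertwines \<open>f\<close> and \<open>g\<close> everywhere, but is injective on a hyperplane
    of constant \<open>x t\<close> only if that constant is nonzero.\<close>
  define \<sigma> :: "(nat \<Rightarrow> real) \<Rightarrow> nat \<Rightarrow> real" where "\<sigma> = (\<lambda>x k. if k = t then x t else x t * x k)"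
  have \<sigma>_smooth: "smooth_map \<sigma>"
    unfolding smooth_map_def \<sigma>_def by (intro allI smooth_intros)
  have tt: "no_component t (homogenise t S)" using t(1) by (auto simp: no_component_def homogenise_def)
  have ft: "f x t = x t" and gt: "g x t = x t" for x
    using sparse_eval_no_component[OF t(1)] sparse_eval_no_component[OF tt] by (simp_all add: f_def g_def perturb_def)
  have mon_\<sigma>: "mon (\<sigma> x) ks = x t ^ length ks * mon x ks" if "t \<notin> set ks" for x ks
    using that by (induction ks) (auto simp: \<sigma>_def)
  have pow: "x t ^ d = x t * x t ^ (d - 1)" if "2 \<le> d" for x :: "nat \<Rightarrow> real" and d
    using that by (cases d) auto
  have "sparse_eval S (\<sigma> x) i = x t * sparse_eval (homogenise t S) x i" for x i
    using t(2) S unfolding no_variable_def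
    by (induction S) (auto simp: mon_\<sigma> pow algebra_simps)
  then have f\<sigma>: "f (\<sigma> x) = \<sigma> (g x)" for x
  proof -
    assume *: "\<And>x i. sparse_eval S (\<sigma> x) i = x t * sparse_eval (homogenise t S) x i"
    have "f (\<sigma> x) k = \<sigma> (g x) k" for k
    proof (cases "k = t")
      case True
      then show ?thesis by (simp add: ft \<sigma>_def gt)
    next
      case False
      have "f (\<sigma> x) k = \<sigma> x k + x t * sparse_eval (homogenise t S) x k"
        by (simp add: f_def perturb_def *)
      also have "\<dots> = x t * g x k" using False by (simp add: g_def perturb_def \<sigma>_def distrib_left)
      also have "\<dots> = \<sigma> (g x) k" using False by (simp add: \<sigma>_def gt)
      finally show ?thesis .
    qed
    then show ?thesis by blast
  qed
  have f_upd: "f (x(t := r)) = (f x)(t := r)" for x r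
  proof
    fix k show "f (x(t := r)) k = ((f x)(t := r)) k"
      using sparse_eval_no_variable[OF t(2)] by (cases "k = t") (simp_all add: ft, simp add: f_def perturb_def)
  qed
  have g1: "g x = f x" if "x t = 1" for x
  proof -
    have "sparse_eval (homogenise t S) x i = sparse_eval S x i" for i
      using that by (induction S) auto
    then show ?thesis by (auto simp: f_def g_def perturb_def)
  qed
  have g0: "g x = x" if "x t = 0" for x
  proof -
    have "sparse_eval (homogenise t S) x i = 0" for i
      using that S by (induction S) (auto simp: power_0_left)
    then show ?thesis by (auto simp: g_def perturb_def)
  qed
  have \<sigma>_inj: "x = y" if "\<sigma> x = \<sigma> y" "x t = y t" "y t \<noteq> 0" for x y
  proof
    fix k
    have "\<sigma> x k = \<sigma> y k" using that(1) by simp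
    then show "x k = y k" using that(2,3) by (simp add: \<sigma>_def split: if_splits)
  qed
  have bounds: "fibers_bounded f b \<longleftrightarrow> fibers_bounded g b" if b: "b > 0" for b
  proof
    assume f: "fibers_bounded f b"
    show "fibers_bounded g b"
      unfolding fibers_bounded_def
    proof
      fix y
      show "finite {x. g x = y} \<and> card {x. g x = y} \<le> b"
      proof (cases "y t = 0")
        case True
        have "x = y" if "g x = y" for x
          using g0[of x] gt[of x] that True by simp
        then have "{x. g x = y} \<subseteq> {y}" by blast
        then show ?thesis
          using finite_card_le_inj[of id "{x. g x = y}" "{y}" b] b by auto
      next
        case False
        show ?thesis
        proof (rule finite_card_le_inj)
          show "inj_on \<sigma> {x. g x = y}"
          proof (rule inj_onI)
            fix x z assume "x \<in> {x. g x = y}" "z \<in> {x. g x = y}" and eq: "\<sigma> x = \<sigma> z"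
            then have "x t = y t" "z t = y t" using gt[of x] gt[of z] by auto
            then show "x = z" using False by (intro \<sigma>_inj[OF eq]) simp_all
          qed
          show "\<sigma> ` {x. g x = y} \<subseteq> {x. f x = \<sigma> y}" using f\<sigma> by auto
        qed (use f in \<open>simp add: fibers_bounded_def\<close>)
      qed
    qed
  next
    assume g: "fibers_bounded g b"
    show "fibers_bounded f b"
      unfolding fibers_bounded_def
    proof
      fix y
      show "finite {x. f x = y} \<and> card {x. f x = y} \<le> b"
      proof (rule finite_card_le_inj)
        \<comment> \<open>As \<open>f\<close> preserves coordinate \<open>t\<close>, a fiber lies in
          one hyperplane of constant \<open>x t\<close>, and moving it to \<open>x t = 1\<close>,
          where \<open>g\<close> agrees with \<open>f\<close>, loses no information.\<close>
        show "inj_on (\<lambda>x. x(t := 1)) {x. f x = y}"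
        proof (rule inj_onI)
          fix x z assume "x \<in> {x. f x = y}" "z \<in> {x. f x = y}" and eq: "x(t := 1) = z(t := 1)"
          then have "x t = z t" using ft[of x] ft[of z] by auto
          show "x = z"
          proof
            fix k show "x k = z k" using fun_cong[OF eq, of k] \<open>x t = z t\<close> by (cases "k = t") auto
          qed
        qed
        show "(\<lambda>x. x(t := 1)) ` {x. f x = y} \<subseteq> {x. g x = y(t := 1)}"
          by (auto simp: g1 f_upd)
      qed (use g in \<open>simp add: fibers_bounded_def\<close>)
    qed
  qed
  have "unramified f \<longleftrightarrow> unramified g"
  proof
    assume f: "unramified f"
    show "unramified g"
      unfolding unramified_def
    proof (intro allI impI)
      fix \<gamma> assume \<gamma>: "curve \<gamma>" "stationary (\<lambda>s. g (\<gamma> s))"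
      have dt: "((\<lambda>s. \<gamma> s t) has_real_derivative 0) (at 0)"
        using \<gamma>(2)[unfolded stationary_def, THEN spec[of _ t]] by (simp only: gt)
      show "stationary \<gamma>"
        unfolding stationary_def
      proof
        fix k
        obtain d where d: "((\<lambda>s. \<gamma> s k) has_real_derivative d) (at 0)"
          using \<gamma>(1) unfolding curve_def by blast
        show "((\<lambda>s. \<gamma> s k) has_real_derivative 0) (at 0)"
        proof (cases "k = t \<or> \<gamma> 0 t \<noteq> 0")
          case True
          \<comment> \<open>For \<open>k \<noteq> t\<close> the curve is tested through
            \<open>\<sigma>\<close>: as it is stationary in coordinate \<open>t\<close>, the product
            rule leaves \<open>\<gamma> 0 t * d = 0\<close>.\<close>
          have "stationary (\<lambda>s. \<sigma> (g (\<gamma> s)))" using \<gamma>(2) by (rule smooth_map_stationary[OF \<sigma>_smooth])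
          then have "stationary (\<lambda>s. \<sigma> (\<gamma> s))"
            using f smooth_map_curve[OF \<sigma>_smooth \<gamma>(1)] unfolding unramified_def f\<sigma>[symmetric] by blast
          then have 1: "((\<lambda>s. \<sigma> (\<gamma> s) k) has_real_derivative 0) (at 0)" unfolding stationary_def by blast
          show ?thesis
          proof (cases "k = t")
            case False
            have "((\<lambda>s. \<gamma> s t * \<gamma> s k) has_real_derivative 0) (at 0)" using 1 False by (simp add: \<sigma>_def)
            from DERIV_unique[OF this DERIV_mult[OF dt d]] have "\<gamma> 0 t * d = 0" by (simp add: mult.commute)
            then have "d = 0" using True False by simp
            then show ?thesis using d by simp
          qed (use dt in simp)
        next
          case False
          \<comment> \<open>All terms have degree at least 2, so each homogenised term contains the
            factor \<open>x t\<close>; \<open>q\<close> collects the cofactors. Where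
            \<open>x t\<close> and its derivative both vanish, \<open>x t * q x\<close> does not
            affect the derivative.\<close>
          define q where "q x = (\<Sum>u\<leftarrow>S. if fst u = k then fst (snd u) * (x t ^ (length (snd (snd u)) - 2) * mon x (snd (snd u))) else 0)"
            for x :: "nat \<Rightarrow> real"
          have "sparse_eval (homogenise t S) x k = x t * q x" for x
          proof -
            have "x t ^ (d - Suc 0) = x t * x t ^ (d - 2)" if "2 \<le> d" for d
              using that by (cases d; cases "d - 1") auto
            then show ?thesis
              using S unfolding q_def by (induction S) (auto simp: algebra_simps)
          qed
          then have gk: "g x k = x k + x t * q x" for x by (simp add: g_def perturb_def)
          have "smooth q"
          proof -
            have "smooth (\<lambda>x. x t ^ d)" for d by (induction d) (auto intro: smooth_intros)
            then show ?thesis unfolding q_def by (auto intro!: smooth_intros)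
          qed
          then obtain d' where d': "((\<lambda>s. q (\<gamma> s)) has_real_derivative d') (at 0)"
            using \<gamma>(1) unfolding smooth_def by blast
          have "((\<lambda>s. \<gamma> s k + \<gamma> s t * q (\<gamma> s)) has_real_derivative 0) (at 0)"
            using \<gamma>(2)[unfolded stationary_def, THEN spec[of _ k]] by (simp only: gk)
          from DERIV_unique[OF this DERIV_add[OF d DERIV_mult[OF dt d']]] have "d = 0"
            using False by simp
          then show ?thesis using d by simp
        qed
      qed
    qed
  next
    assume g: "unramified g"
    show "unramified f"
      unfolding unramified_def
    proof (intro allI impI)
      fix \<gamma> assume \<gamma>: "curve \<gamma>" "stationary (\<lambda>s. f (\<gamma> s))"
      \<comment> \<open>The curve is moved into the hyperplane \<open>x t = 1\<close>, where
        \<open>f\<close> and \<open>g\<close> agree.\<close>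
      have eq: "g ((\<gamma> s)(t := 1)) = (f (\<gamma> s))(t := 1)" for s by (simp add: g1 f_upd)
      have upd: "smooth_map (\<lambda>x. x(t := 1))" unfolding smooth_map_def by (auto intro: smooth_intros)
      have "stationary (\<lambda>s. (f (\<gamma> s))(t := 1))" using \<gamma>(2) by (rule smooth_map_stationary[OF upd])
      then have st: "stationary (\<lambda>s. (\<gamma> s)(t := 1))"
        using g smooth_map_curve[OF upd \<gamma>(1)] unfolding unramified_def eq[symmetric] by blast
      show "stationary \<gamma>"
        unfolding stationary_def
      proof
        fix k show "((\<lambda>s. \<gamma> s k) has_real_derivative 0) (at 0)"
        proof (cases "k = t")
          case True
          have "((\<lambda>s. f (\<gamma> s) t) has_real_derivative 0) (at 0)" using \<gamma>(2) unfolding stationary_def by blast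
          then show ?thesis using True by (simp add: ft)
        next
          case False
          then show ?thesis using spec[OF st[unfolded stationary_def], of k] by simp
        qed
      qed
    qed
  qed
  then show ?thesis using bounds unfolding same_type_def f_def g_def by blast
qed

text \<open>With \<open>A = mon x ks\<close>, the source automorphism turns \<open>y\<close> into
  \<open>y - A\<close>. Adding \<open>c t^2\<close> times component \<open>y\<close> to component
  \<open>i\<close> of the image then cancels \<open>c t^2 A\<close> and leaves
  \<open>c t^2 y\<close>.\<close>

lemma same_type_quintic:
  assumes t: "no_component t L" and y: "no_component y L" "no_variable y L" "y \<notin> set ks"
    and ne: "i \<noteq> t" "i \<noteq> y" "t \<noteq> y"
  shows "same_type (perturb ((i, c, [t, t] @ ks) # L)) (perturb ((i, c, [t, t, y]) # (y, - 1, ks) # L))"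
    (is "same_type ?f ?g")
proof -
  have E: "inverse_maps (\<lambda>x. x(y := x y + - mon x ks)) (\<lambda>x. x(y := x y - - mon x ks))"
    using y(3) smooth_mult[OF smooth_const[of "-1"] smooth_mon[of ks]]
    by (intro inverse_maps_update) (auto intro!: mon_cong)
  have D: "inverse_maps (\<lambda>u. u(i := u i + c * (u t * u t * u y))) (\<lambda>u. u(i := u i - c * (u t * u t * u y)))"
    using ne by (intro inverse_maps_update) (auto intro!: smooth_intros)
  have mon_upd: "mon (x(y := r)) ks = mon x ks" for x r using y(3) by (auto intro!: mon_cong)
  show ?thesis
    using ne sparse_eval_no_component[OF t] sparse_eval_no_component[OF y(1)] sparse_eval_no_variable[OF y(2)]
    by (intro same_type_conjugate[OF E D])
       (auto simp: fun_eq_iff perturb_def mon_upd algebra_simps)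
qed

text \<open>With \<open>A\<close>, \<open>B\<close> the monomials \<open>as\<close>,
  \<open>bs\<close>, this rests on \<open>A B - (y - A) (z - B) = - y z + y B + z A\<close>. The
  factors \<open>y - A\<close> and \<open>z - B\<close> are components of the image and
  \<open>t\<close> is preserved, so \<open>c t (y - A) (z - B)\<close> can be subtracted in the
  target.\<close>

lemma same_type_split:
  assumes t: "no_component t L" and y: "no_component y L" "no_variable y L" "y \<notin> set as" "y \<notin> set bs"
    and z: "no_component z L" "no_variable z L" "z \<notin> set as" "z \<notin> set bs"
    and ne: "i \<noteq> t" "i \<noteq> y" "i \<noteq> z" "t \<noteq> y" "t \<noteq> z" "y \<noteq> z"
  shows "same_type (perturb ((i, c, t # as @ bs) # L))
    (perturb ((i, c, t # y # bs) # (z, - 1, bs) # (i, c, t # z # as) # (i, - c, [t, y, z]) # (y, - 1, as) # L))"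
proof -
  have E1: "inverse_maps (\<lambda>x. x(y := x y + - mon x as)) (\<lambda>x. x(y := x y - - mon x as))"
    using y smooth_mult[OF smooth_const[of "-1"] smooth_mon[of as]]
    by (intro inverse_maps_update) (auto intro!: mon_cong)
  have E2: "inverse_maps (\<lambda>x. x(z := x z + - mon x bs)) (\<lambda>x. x(z := x z - - mon x bs))"
    using z smooth_mult[OF smooth_const[of "-1"] smooth_mon[of bs]]
    by (intro inverse_maps_update) (auto intro!: mon_cong)
  have D: "inverse_maps (\<lambda>u. u(i := u i + - c * (u t * u y * u z))) (\<lambda>u. u(i := u i - - c * (u t * u y * u z)))"
    using ne by (intro inverse_maps_update) (auto intro!: smooth_intros)
  have mon_upd: "mon (x(y := r)) as = mon x as" "mon (x(y := r)) bs = mon x bs"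
    "mon (x(z := r)) as = mon x as" "mon (x(z := r)) bs = mon x bs" for x r
    using y z by (auto intro!: mon_cong)
  show ?thesis
    using ne sparse_eval_no_component[OF t] sparse_eval_no_component[OF y(1)] sparse_eval_no_variable[OF y(2)]
      sparse_eval_no_component[OF z(1)] sparse_eval_no_variable[OF z(2)]
    by (intro same_type_conjugate[OF inverse_maps_comp[OF E1 E2] D])
       (auto simp: fun_eq_iff perturb_def mon_upd algebra_simps)
qed

section \<open>Polynomial maps in coordinates\<close>

lemma weigh_simps [simp]:
  "weigh w [] = 0"
  "weigh w (t # p) = fst t * w (snd t) + weigh w p"
  "weigh w (p @ q) = weigh w p + weigh w q"
  by (simp_all add: weigh_def)

lemma weigh_concat_map: "weigh w (concat (map f xs)) = (\<Sum>x\<leftarrow>xs. weigh w (f x))"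
  by (induction xs) auto

lemma weigh_scale_terms: "weigh w (scale_terms c p) = c * weigh w p"
  by (induction p) (auto simp: scale_terms_def algebra_simps)

lemma weigh_cong: "(\<And>t. t \<in> set p \<Longrightarrow> w (snd t) = w' (snd t)) \<Longrightarrow> weigh w p = weigh w' p"
  by (induction p) auto

lemma weigh_linear_combination:
  "finite A \<Longrightarrow> weigh (\<lambda>ks. \<Sum>j\<in>A. c j * w j ks) p = (\<Sum>j\<in>A. c j * weigh (w j) p)"
  by (induction p) (simp_all add: sum.distrib sum_distrib_left algebra_simps)

lemma vars_below_iff: "vars_below n p \<longleftrightarrow> (\<forall>t\<in>set p. \<forall>k\<in>set (snd t). k < n)"
  unfolding vars_below_def by (auto simp: case_prod_beta)

lemma weigh_shift: "weigh (mon x) (shift a p) = weigh (mon (\<lambda>k. a k + x k)) p"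
proof -
  have 1: "weigh (mon x) (shift_step a k q) = (a k + x k) * weigh (mon x) q" for k q
    by (induction q) (auto simp: shift_step_def algebra_simps)
  have 2: "weigh (mon x) (foldl (\<lambda>q k. shift_step a k q) q ks) = mon (\<lambda>k. a k + x k) ks * weigh (mon x) q" for q ks
    by (induction ks arbitrary: q) (simp_all add: 1)
  show ?thesis by (induction p) (simp_all add: shift_def 2)
qed

lemma vars_below_shift:
  assumes "vars_below n p"
  shows "vars_below n (shift a p)"
proof -
  have 1: "vars_below n (shift_step a k q)" if "vars_below n q" "k < n" for k q
    using that by (fastforce simp: shift_step_def vars_below_iff)
  have 2: "vars_below n (foldl (\<lambda>q k. shift_step a k q) q ks)" if "vars_below n q" "\<forall>k\<in>set ks. k < n" for q ks
    using that by (induction ks arbitrary: q) (simp_all add: 1)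
  have 3: "vars_below n (foldl (\<lambda>q k. shift_step a k q) [(fst t, [])] (snd t))" if "t \<in> set p" for t
    using assms that by (intro 2) (simp_all add: vars_below_iff)
  then show ?thesis unfolding shift_def vars_below_iff set_concat set_map by blast
qed

lemma shift_cong:
  assumes "vars_below n p" "\<And>k. k < n \<Longrightarrow> a k = b k"
  shows "shift a p = shift b p"
proof -
  have "foldl (\<lambda>q k. shift_step a k q) q ks = foldl (\<lambda>q k. shift_step b k q) q ks" if "\<forall>k\<in>set ks. k < n" for q ks
    using that assms(2) by (induction ks arbitrary: q) (simp_all add: shift_step_def)
  then have "foldl (\<lambda>q k. shift_step a k q) [(fst t, [])] (snd t) = foldl (\<lambda>q k. shift_step b k q) [(fst t, [])] (snd t)"
    if "t \<in> set p" for t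
    using assms(1) that by (simp add: vars_below_iff)
  then show ?thesis unfolding shift_def by (simp cong: map_cong)
qed

text \<open>The derivative of a monomial at the origin in direction \<open>v\<close>, to which only
  degree 1 contributes.\<close>

definition first_order :: "(nat \<Rightarrow> real) \<Rightarrow> nat list \<Rightarrow> real" where
  "first_order v ks = (case ks of [] \<Rightarrow> 0 | k # r \<Rightarrow> (case r of [] \<Rightarrow> v k | h # r' \<Rightarrow> 0))"

lemma first_order_lin_weight:
  assumes "\<forall>k\<in>set ks. k < n"
  shows "first_order v ks = (\<Sum>j<n. v j * lin_weight j ks)"
proof (cases ks)
  case (Cons k r)
  have "(\<Sum>j<n. v j * (if k = j then 1 else 0)) = (\<Sum>j<n. if k = j then v j else 0)"
    by (intro sum.cong) auto
  then show ?thesis using assms Cons by (cases r) (auto simp: first_order_def lin_weight_def)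
qed (simp add: first_order_def lin_weight_def)

lemma mon_first_order:
  assumes "\<And>k. ((\<lambda>s. \<delta> s k) has_real_derivative v k) (at 0)" and 0: "\<And>k. \<delta> 0 k = 0"
  shows "((\<lambda>s. mon (\<delta> s) ks) has_real_derivative first_order v ks) (at 0)"
proof (induction ks)
  case (Cons k ks)
  have "mon (\<delta> 0) ks = (if ks = [] then 1 else 0)" by (cases ks) (auto simp: 0)
  then show ?case using DERIV_mult[OF assms(1)[of k] Cons]
    by (cases ks) (simp_all add: 0 first_order_def)
qed (simp add: first_order_def)

text \<open>Taylor expansion at \<open>\<gamma> 0\<close>: once this point is moved to the origin,
  only linear terms contribute to the derivative.\<close>

lemma weigh_derivative:
  assumes \<gamma>: "\<And>k. ((\<lambda>s. \<gamma> s k) has_real_derivative v k) (at 0)" and p: "vars_below n p"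
  shows "((\<lambda>s. weigh (mon (\<gamma> s)) p) has_real_derivative (\<Sum>j<n. v j * lin j (shift (\<gamma> 0) p))) (at 0)"
proof -
  define \<delta> where "\<delta> s k = \<gamma> s k - \<gamma> 0 k" for s k
  have \<delta>: "((\<lambda>s. \<delta> s k) has_real_derivative v k) (at 0)" for k
    unfolding \<delta>_def using DERIV_diff[OF \<gamma>[of k] DERIV_const[of "\<gamma> 0 k"]] by simp
  have \<delta>0: "\<delta> 0 k = 0" for k by (simp add: \<delta>_def)
  have deriv: "((\<lambda>s. weigh (mon (\<delta> s)) q) has_real_derivative weigh (first_order v) q) (at 0)" for q
  proof (induction q)
    case (Cons t q)
    show ?case
      using DERIV_add[OF DERIV_cmult[OF mon_first_order[where \<delta> = \<delta> and v = v, OF \<delta> \<delta>0]] Cons, of "fst t" "snd t"]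
      by simp
  qed simp
  have eval_eq: "weigh (mon (\<delta> s)) (shift (\<gamma> 0) p) = weigh (mon (\<gamma> s)) p" for s
    by (simp add: weigh_shift \<delta>_def)
  have "weigh (first_order v) (shift (\<gamma> 0) p) = (\<Sum>j<n. v j * lin j (shift (\<gamma> 0) p))"
  proof -
    have "weigh (first_order v) (shift (\<gamma> 0) p) = weigh (\<lambda>ks. \<Sum>j<n. v j * lin_weight j ks) (shift (\<gamma> 0) p)"
      using vars_below_shift[OF p] by (intro weigh_cong first_order_lin_weight) (simp add: vars_below_iff)
    then show ?thesis by (simp add: weigh_linear_combination lin_def)
  qed
  then show ?thesis using deriv[of "shift (\<gamma> 0) p"] by (simp only: eval_eq)
qed

section \<open>Matrices given by functions of two indices\<close>

definition matrix_of :: "nat \<Rightarrow> (nat \<Rightarrow> nat \<Rightarrow> real) \<Rightarrow> real Matrix.mat" where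
  "matrix_of n A = Matrix.mat n n (\<lambda>(i, j). A i j)"

lemma matrix_of_carrier [simp]: "matrix_of n A \<in> carrier_mat n n"
  by (simp add: matrix_of_def)

lemma matrix_of_mult:
  "matrix_of n A * matrix_of n B = matrix_of n (\<lambda>i j. \<Sum>k<n. A i k * B k j)"
  unfolding matrix_of_def by (rule eq_matI) (auto simp: scalar_prod_def lessThan_atLeast0)

lemma matrix_of_eq_one_iff:
  "matrix_of n A = 1\<^sub>m n \<longleftrightarrow> (\<forall>i<n. \<forall>j<n. A i j = (if i = j then 1 else 0))"
  (is "?l \<longleftrightarrow> ?r")
proof
  assume l: ?l
  show ?r
  proof (intro allI impI)
    fix i j assume "i < n" "j < n"
    then show "A i j = (if i = j then 1 else 0)"
      using arg_cong[OF l, of "\<lambda>M. M $$ (i, j)"] by (simp add: matrix_of_def)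
  qed
qed (auto simp: matrix_of_def intro!: eq_matI)

lemma right_inverse_left_inverse:
  fixes A B :: "nat \<Rightarrow> nat \<Rightarrow> real"
  assumes "\<And>i j. i < n \<Longrightarrow> j < n \<Longrightarrow> (\<Sum>k<n. A i k * B k j) = (if i = j then 1 else 0)"
    and "i < n" "j < n"
  shows "(\<Sum>k<n. B i k * A k j) = (if i = j then 1 else 0)"
proof -
  have "matrix_of n A * matrix_of n B = 1\<^sub>m n"
    using assms(1) by (simp add: matrix_of_mult matrix_of_eq_one_iff)
  then have "matrix_of n B * matrix_of n A = 1\<^sub>m n"
    by (rule mat_mult_left_right_inverse[rotated 2]) simp_all
  then show ?thesis using assms(2,3) by (simp add: matrix_of_mult matrix_of_eq_one_iff)
qed

lemma det_eq_0_iff_kernel: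
  "Determinant.det (matrix_of n A) = 0 \<longleftrightarrow>
     (\<exists>v. (\<exists>j<n. v j \<noteq> 0) \<and> (\<forall>i<n. (\<Sum>j<n. A i j * v j) = 0))"
  (is "_ \<longleftrightarrow> ?r")
proof -
  have row: "(matrix_of n A *\<^sub>v v) $ i = (\<Sum>j<n. A i j * v $ j)" if "i < n" "v \<in> carrier_vec n" for v i
    using that by (simp add: matrix_of_def scalar_prod_def lessThan_atLeast0)
  have "?r \<longleftrightarrow> (\<exists>v. v \<in> carrier_vec n \<and> v \<noteq> 0\<^sub>v n \<and> matrix_of n A *\<^sub>v v = 0\<^sub>v n)"
  proof
    assume ?r
    then obtain v j where v: "j < n" "v j \<noteq> 0" "\<forall>i<n. (\<Sum>j<n. A i j * v j) = 0" by blast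
    have "Matrix.vec n v \<noteq> 0\<^sub>v n"
    proof
      assume "Matrix.vec n v = 0\<^sub>v n"
      then have "Matrix.vec n v $ j = 0\<^sub>v n $ j" by simp
      then show False using v by simp
    qed
    moreover have "matrix_of n A *\<^sub>v Matrix.vec n v = 0\<^sub>v n"
      using v(3) row[of _ "Matrix.vec n v"] by (intro eq_vecI) (auto simp: matrix_of_def)
    ultimately show "\<exists>v. v \<in> carrier_vec n \<and> v \<noteq> 0\<^sub>v n \<and> matrix_of n A *\<^sub>v v = 0\<^sub>v n"
      by (intro exI[of _ "Matrix.vec n v"]) simp
  next
    assume "\<exists>v. v \<in> carrier_vec n \<and> v \<noteq> 0\<^sub>v n \<and> matrix_of n A *\<^sub>v v = 0\<^sub>v n"
    then obtain v where v: "v \<in> carrier_vec n" "v \<noteq> 0\<^sub>v n" "matrix_of n A *\<^sub>v v = 0\<^sub>v n" by blast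
    have "\<exists>j<n. v $ j \<noteq> 0"
    proof (rule ccontr)
      assume "\<not> (\<exists>j<n. v $ j \<noteq> 0)"
      then have "v = 0\<^sub>v n" using v(1) by (intro eq_vecI) auto
      then show False using v(2) by simp
    qed
    moreover have "\<forall>i<n. (\<Sum>j<n. A i j * v $ j) = 0" using row[OF _ v(1)] v(3) by simp
    ultimately show ?r by blast
  qed
  then show ?thesis using det_0_iff_vec_prod_zero[OF matrix_of_carrier, of n A] by simp
qed

text \<open>The Jacobian determinant at the origin; after a shift by \<open>a\<close>, the one at
  \<open>a\<close>.\<close>

definition lin_det :: "nat \<Rightarrow> terms list \<Rightarrow> real" where
  "lin_det n rs = Determinant.det (matrix_of n (\<lambda>i j. lin j (rs ! i)))"

section \<open>Passage between vectors of length \<open>n\<close> and infinite sequences of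
  coordinates\<close>

definition coords :: "nat \<Rightarrow> real Matrix.vec \<Rightarrow> nat \<Rightarrow> real" where
  "coords n v k = (if k < n then v $ k else 0)"

definition stabilise :: "terms list \<Rightarrow> (nat \<Rightarrow> real) \<Rightarrow> nat \<Rightarrow> real" where
  "stabilise P x i = (if i < length P then weigh (mon x) (P ! i) else x i)"

lemma eval_terms_weigh:
  assumes "vars_below n p" "\<And>k. k < n \<Longrightarrow> v $ k = x k"
  shows "eval_terms p v = weigh (mon x) p"
proof -
  have "prod_list (map (($) v) ks) = mon x ks" if "\<forall>k\<in>set ks. k < n" for ks
    using that assms(2) by (induction ks) auto
  then show ?thesis using assms(1)
    by (induction p) (auto simp: eval_terms_def vars_below_iff)
qed

lemma presents_component:
  assumes "presents n P F" "x \<in> carrier_vec n" "i < n" "\<And>k. k < n \<Longrightarrow> x $ k = y k"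
  shows "F x $ i = weigh (mon y) (P ! i)"
  using assms eval_terms_weigh[of n "P ! i" x y] by (auto simp: presents_def)

text \<open>On a fiber of \<open>stabilise P\<close> the coordinates beyond \<open>n\<close> are
  fixed, so cutting them off is injective there. Conversely, extension by 0 embeds the fibers of
  \<open>F\<close>.\<close>

lemma fibers_at_most_iff:
  assumes P: "presents n P F"
  shows "fibers_at_most n F b \<longleftrightarrow> fibers_bounded (stabilise P) b"
proof
  have len: "length P = n" using P by (simp add: presents_def)
  show "fibers_bounded (stabilise P) b" if F: "fibers_at_most n F b"
    unfolding fibers_bounded_def
  proof
    fix y
    show "finite {x. stabilise P x = y} \<and> card {x. stabilise P x = y} \<le> b"
    proof (rule finite_card_le_inj)
      show "inj_on (Matrix.vec n) {x. stabilise P x = y}"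
      proof (rule inj_onI)
        fix x z assume xz: "x \<in> {x. stabilise P x = y}" "z \<in> {x. stabilise P x = y}" and eq: "Matrix.vec n x = Matrix.vec n z"
        show "x = z"
        proof
          fix k
          show "x k = z k"
          proof (cases "k < n")
            case True
            then show ?thesis using arg_cong[OF eq, of "\<lambda>v. v $ k"] by simp
          next
            case False
            have "stabilise P x k = stabilise P z k" using xz by simp
            then show ?thesis using False by (simp add: stabilise_def len)
          qed
        qed
      qed
      show "Matrix.vec n ` {x. stabilise P x = y} \<subseteq> fiber n F (Matrix.vec n y)"
      proof
        fix v assume "v \<in> Matrix.vec n ` {x. stabilise P x = y}"
        then obtain x where x: "v = Matrix.vec n x" "stabilise P x = y" by blast
        have "F v = Matrix.vec n y"
        proof (rule eq_vecI)
          fix i assume "i < dim_vec (Matrix.vec n y)"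
          then have i: "i < n" by simp
          then have "F v $ i = weigh (mon x) (P ! i)"
            using x(1) by (intro presents_component[OF P]) auto
          then show "F v $ i = Matrix.vec n y $ i"
            using i x(2) by (auto simp: stabilise_def len)
        qed (use P x(1) in \<open>auto simp: presents_def\<close>)
        then show "v \<in> fiber n F (Matrix.vec n y)" by (simp add: fiber_def x(1))
      qed
      show "finite (fiber n F (Matrix.vec n y)) \<and> card (fiber n F (Matrix.vec n y)) \<le> b"
        using F by (simp add: fibers_at_most_def)
    qed
  qed
  show "fibers_at_most n F b" if f: "fibers_bounded (stabilise P) b"
    unfolding fibers_at_most_def
  proof
    fix y :: "real Matrix.vec" assume y: "y \<in> carrier_vec n"
    show "finite (fiber n F y) \<and> card (fiber n F y) \<le> b"
    proof (rule finite_card_le_inj)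
      show "inj_on (coords n) (fiber n F y)"
      proof (rule inj_onI)
        fix x z assume "x \<in> fiber n F y" "z \<in> fiber n F y" and eq: "coords n x = coords n z"
        then have xz: "x \<in> carrier_vec n" "z \<in> carrier_vec n" by (auto simp: fiber_def)
        show "x = z"
        proof (rule eq_vecI)
          fix k assume "k < dim_vec z"
          then show "x $ k = z $ k" using fun_cong[OF eq, of k] xz by (simp add: coords_def)
        qed (use xz in simp)
      qed
      show "coords n ` fiber n F y \<subseteq> {x. stabilise P x = coords n y}"
      proof
        fix x assume "x \<in> coords n ` fiber n F y"
        then obtain v where v: "x = coords n v" "v \<in> carrier_vec n" "F v = y" by (auto simp: fiber_def)
        have "stabilise P x i = coords n y i" for i
          using presents_component[OF P v(2), of i x] v(3)
          by (auto simp: v(1) stabilise_def coords_def len)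
        then show "x \<in> {x. stabilise P x = coords n y}" by blast
      qed
      show "finite {x. stabilise P x = coords n y} \<and> card {x. stabilise P x = coords n y} \<le> b"
        using f by (simp add: fibers_bounded_def)
    qed
  qed
qed

text \<open>Along the line through \<open>x\<close> in coordinate direction \<open>j\<close>, the
  derivative of a component is its linear coefficient \<open>j\<close> after the shift to
  \<open>x\<close>.\<close>

lemma jacobian_det_eq:
  assumes P: "presents n P F" and x: "x \<in> carrier_vec n"
  shows "jacobian_det n F x = lin_det n (map (shift (coords n x)) P)"
proof -
  have len: "length P = n" using P by (simp add: presents_def)
  have "deriv (\<lambda>t. F (x + t \<cdot>\<^sub>v unit_vec n j) $ i) 0 = lin j (shift (coords n x) (P ! i))"
    if i: "i < n" and j: "j < n" for i j
  proof -
    define \<gamma> where "\<gamma> t k = (if k < n then x $ k else 0) + t * (if k = j then 1 else 0)" for t :: real and k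
    have \<gamma>: "((\<lambda>t. \<gamma> t k) has_real_derivative (if k = j then 1 else 0)) (at 0)" for k
      unfolding \<gamma>_def by (auto intro!: derivative_eq_intros)
    have "F (x + t \<cdot>\<^sub>v unit_vec n j) $ i = weigh (mon (\<gamma> t)) (P ! i)" for t
      using x i j by (intro presents_component[OF P]) (auto simp: \<gamma>_def)
    moreover have "\<gamma> 0 = coords n x" by (auto simp: \<gamma>_def coords_def)
    moreover have "vars_below n (P ! i)" using P i by (auto simp: presents_def)
    ultimately have "((\<lambda>t. F (x + t \<cdot>\<^sub>v unit_vec n j) $ i) has_real_derivative
        (\<Sum>k<n. (if k = j then 1 else 0) * lin k (shift (coords n x) (P ! i)))) (at 0)"
      using weigh_derivative[where \<gamma> = \<gamma>, OF \<gamma>, of n "P ! i"] by simp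
    moreover have "(\<Sum>k<n. (if k = j then 1 else 0) * lin k (shift (coords n x) (P ! i)))
        = (\<Sum>k<n. if k = j then lin k (shift (coords n x) (P ! i)) else 0)"
      by (intro sum.cong) auto
    ultimately show ?thesis using j by (simp add: DERIV_imp_deriv)
  qed
  then have "Matrix.mat n n (\<lambda>(i, j). deriv (\<lambda>t. F (x + t \<cdot>\<^sub>v unit_vec n j) $ i) 0)
      = matrix_of n (\<lambda>i j. lin j (map (shift (coords n x)) P ! i))"
    unfolding matrix_of_def by (intro eq_matI) (auto simp: len)
  then show ?thesis by (simp add: jacobian_det_def lin_det_def)
qed

lemma map_shift_cong:
  assumes "length P = n" "\<forall>p\<in>set P. vars_below n p" "\<And>k. k < n \<Longrightarrow> a k = b k"
  shows "map (shift a) P = map (shift b) P"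
  using assms(2) by (intro map_cong refl shift_cong[OF _ assms(3)]) simp_all

text \<open>A kernel vector of the Jacobian matrix is the velocity of a line with stationary image;
  conversely, the velocity of a curve with stationary image lies in the kernel.\<close>

lemma unramified_stabilise_iff:
  assumes len: "length P = n" and vars: "\<forall>p\<in>set P. vars_below n p"
  shows "unramified (stabilise P) \<longleftrightarrow> (\<forall>a. lin_det n (map (shift a) P) \<noteq> 0)"
proof
  have comp: "((\<lambda>s. stabilise P (\<gamma> s) i) has_real_derivative (\<Sum>j<n. lin j (map (shift (\<gamma> 0)) P ! i) * v j)) (at 0)"
    if "\<And>k. ((\<lambda>s. \<gamma> s k) has_real_derivative v k) (at 0)" "i < n" for \<gamma> v i
    using weigh_derivative[where \<gamma> = \<gamma>, OF that(1), of n "P ! i"] that(2) vars len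
    by (simp add: stabilise_def mult.commute)
  show "\<forall>a. lin_det n (map (shift a) P) \<noteq> 0" if u: "unramified (stabilise P)"
  proof (rule allI, rule notI)
    fix a assume "lin_det n (map (shift a) P) = 0"
    then obtain v j where v: "j < n" "v j \<noteq> 0" "\<forall>i<n. (\<Sum>j<n. lin j (map (shift a) P ! i) * v j) = 0"
      unfolding lin_det_def det_eq_0_iff_kernel by blast
    \<comment> \<open>Beyond \<open>n\<close> the map is the identity, so the line has to be
      constant there.\<close>
    define w where "w k = (if k < n then v k else 0)" for k
    define \<gamma> where "\<gamma> s k = a k + s * w k" for s k
    have \<gamma>: "((\<lambda>s. \<gamma> s k) has_real_derivative w k) (at 0)" for k
      unfolding \<gamma>_def by (auto intro!: derivative_eq_intros)
    have \<gamma>0: "\<gamma> 0 = a" by (simp add: \<gamma>_def fun_eq_iff)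
    have "curve \<gamma>" using \<gamma> unfolding curve_def by blast
    moreover have "stationary (\<lambda>s. stabilise P (\<gamma> s))"
      unfolding stationary_def
    proof
      fix i
      show "((\<lambda>s. stabilise P (\<gamma> s) i) has_real_derivative 0) (at 0)"
      proof (cases "i < n")
        case True
        have "(\<Sum>j<n. lin j (map (shift a) P ! i) * w j) = 0" using v(3) True by (simp add: w_def)
        then show ?thesis using comp[where \<gamma> = \<gamma> and v = w, OF \<gamma> True] by (simp add: \<gamma>0)
      next
        case False
        then show ?thesis using \<gamma>[of i] by (simp add: stabilise_def len w_def)
      qed
    qed
    ultimately have "stationary \<gamma>" using u unfolding unramified_def by blast
    then have "w j = 0" using \<gamma>[of j] DERIV_unique unfolding stationary_def by blast
    then show False using v(1,2) by (simp add: w_def)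
  qed
  show "unramified (stabilise P)" if d: "\<forall>a. lin_det n (map (shift a) P) \<noteq> 0"
    unfolding unramified_def
  proof (intro allI impI)
    fix \<gamma> assume "curve \<gamma>" and st: "stationary (\<lambda>s. stabilise P (\<gamma> s))"
    then obtain v where v: "\<And>k. ((\<lambda>s. \<gamma> s k) has_real_derivative v k) (at 0)"
      unfolding curve_def by metis
    have "(\<Sum>j<n. lin j (map (shift (\<gamma> 0)) P ! i) * v j) = 0" if "i < n" for i
      using DERIV_unique[OF comp[where \<gamma> = \<gamma> and v = v, OF v that]] st unfolding stationary_def by blast
    then have small: "v j = 0" if "j < n" for j
      using d[rule_format, of "\<gamma> 0"] that unfolding lin_det_def det_eq_0_iff_kernel by blast
    show "stationary \<gamma>"
      unfolding stationary_def
    proof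
      fix k
      show "((\<lambda>s. \<gamma> s k) has_real_derivative 0) (at 0)"
      proof (cases "k < n")
        case True
        then show ?thesis using v[of k] small by simp
      next
        case False
        have "((\<lambda>s. stabilise P (\<gamma> s) k) has_real_derivative 0) (at 0)" using st unfolding stationary_def by blast
        then show ?thesis using False by (simp add: stabilise_def len)
      qed
    qed
  qed
qed

lemma nonsingular_iff:
  assumes P: "presents n P F"
  shows "nonsingular n F \<longleftrightarrow> unramified (stabilise P)"
proof -
  have *: "length P = n" "\<forall>p\<in>set P. vars_below n p" using P by (auto simp: presents_def)
  have "nonsingular n F \<longleftrightarrow> (\<forall>x\<in>carrier_vec n. lin_det n (map (shift (coords n x)) P) \<noteq> 0)"
    using jacobian_det_eq[OF P] by (simp add: nonsingular_def)
  also have "\<dots> \<longleftrightarrow> (\<forall>a. lin_det n (map (shift a) P) \<noteq> 0)"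
  proof
    assume l: "\<forall>x\<in>carrier_vec n. lin_det n (map (shift (coords n x)) P) \<noteq> 0"
    show "\<forall>a. lin_det n (map (shift a) P) \<noteq> 0"
    proof
      fix a
      have "map (shift a) P = map (shift (coords n (Matrix.vec n a))) P"
        by (rule map_shift_cong[OF *]) (simp add: coords_def)
      moreover have "lin_det n (map (shift (coords n (Matrix.vec n a))) P) \<noteq> 0" using l by simp
      ultimately show "lin_det n (map (shift a) P) \<noteq> 0" by metis
    qed
  qed blast
  finally show ?thesis using unramified_stabilise_iff[OF *] by simp
qed

section \<open>Normalisation at a regular point\<close>

lemma sum_list_map_nth: "(\<Sum>x\<leftarrow>xs. f x) = (\<Sum>k<length xs. f (xs ! k) :: real)"
  by (simp add: sum_list_sum_nth lessThan_atLeast0)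

lemma lin_inner_sum: "lin_inner n p q = (\<Sum>j<n. lin j p * lin j q)"
  unfolding lin_inner_def sum_list_map_nth by simp

lemma lin_inner_commute: "lin_inner n p q = lin_inner n q p"
  by (simp add: lin_inner_sum mult.commute)

lemma lin_inner_nonneg: "0 \<le> lin_inner n p p"
  by (auto simp: lin_inner_sum intro: sum_nonneg)

lemma lin_eq_0:
  assumes "lin_inner n p p = 0" "j < n"
  shows "lin j p = 0"
proof -
  have "\<forall>j\<in>{..<n}. lin j p * lin j p = 0"
    using assms(1) unfolding lin_inner_sum by (subst (asm) sum_nonneg_eq_0_iff) auto
  then show ?thesis using assms(2) by simp
qed

lemma gram_schmidt_simps [simp]:
  "gram_schmidt n [] = []"
  "gram_schmidt n (rs @ [r]) = gram_schmidt n rs @ [gram_schmidt_step n (gram_schmidt n rs) r]"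
  by (simp_all add: gram_schmidt_def)

lemma length_gram_schmidt [simp]: "length (gram_schmidt n rs) = length rs"
  by (induction rs rule: rev_induct) auto

lemma weigh_gram_schmidt_step:
  "weigh w (gram_schmidt_step n qs r) = weigh w r -
     (\<Sum>k<length qs. lin_inner n r (qs ! k) / lin_inner n (qs ! k) (qs ! k) * weigh w (qs ! k))"
  by (simp add: gram_schmidt_step_def weigh_concat_map weigh_scale_terms sum_list_map_nth flip: sum_negf)

lemma weigh_normalise:
  "weigh w (normalise n rs i) = (\<Sum>k<length rs. lin i (gram_schmidt n rs ! k) /
     lin_inner n (gram_schmidt n rs ! k) (gram_schmidt n rs ! k) * weigh w (gram_schmidt n rs ! k))"
  by (simp add: normalise_def weigh_concat_map weigh_scale_terms sum_list_map_nth)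

lemma lin_inner_gram_schmidt_step:
  "lin_inner n p (gram_schmidt_step n qs r) = lin_inner n p r -
     (\<Sum>k<length qs. lin_inner n r (qs ! k) / lin_inner n (qs ! k) (qs ! k) * lin_inner n p (qs ! k))"
proof -
  let ?c = "\<lambda>k. lin_inner n r (qs ! k) / lin_inner n (qs ! k) (qs ! k)"
  have "lin_inner n p (gram_schmidt_step n qs r) =
      (\<Sum>j<n. lin j p * lin j r - (\<Sum>k<length qs. ?c k * (lin j p * lin j (qs ! k))))"
    unfolding lin_inner_sum[of n p "gram_schmidt_step n qs r"]
    by (intro sum.cong refl)
       (simp add: lin_def weigh_gram_schmidt_step right_diff_distrib sum_distrib_left mult.left_commute)
  also have "\<dots> = lin_inner n p r - (\<Sum>j<n. \<Sum>k<length qs. ?c k * (lin j p * lin j (qs ! k)))"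
    by (simp add: sum_subtractf lin_inner_sum[of n p r])
  also have "(\<Sum>j<n. \<Sum>k<length qs. ?c k * (lin j p * lin j (qs ! k))) = (\<Sum>k<length qs. ?c k * lin_inner n p (qs ! k))"
    by (subst sum.swap) (simp add: sum_distrib_left lin_inner_sum[of n p])
  finally show ?thesis .
qed

text \<open>Holds without linear independence, so that the regularity test may run on arbitrary
  input.\<close>

lemma gram_schmidt_orthogonal:
  assumes "i < length rs" "j < length rs" "i \<noteq> j"
  shows "lin_inner n (gram_schmidt n rs ! i) (gram_schmidt n rs ! j) = 0"
  using assms
proof (induction rs arbitrary: i j rule: rev_induct)
  case (snoc r rs)
  let ?Q = "gram_schmidt n rs"
  have new: "lin_inner n (?Q ! i) (gram_schmidt_step n ?Q r) = 0" if i: "i < length rs" for i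
  proof -
    let ?c = "\<lambda>k. lin_inner n r (?Q ! k) / lin_inner n (?Q ! k) (?Q ! k)"
    have "(\<Sum>k<length rs. ?c k * lin_inner n (?Q ! i) (?Q ! k)) = (\<Sum>k<length rs. if k = i then ?c k * lin_inner n (?Q ! k) (?Q ! k) else 0)"
      using snoc.IH i by (intro sum.cong) auto
    also have "\<dots> = ?c i * lin_inner n (?Q ! i) (?Q ! i)" using i by simp
    also have "\<dots> = lin_inner n (?Q ! i) r"
    proof (cases "lin_inner n (?Q ! i) (?Q ! i) = 0")
      case True
      \<comment> \<open>Over the reals squared length 0 forces the linear part to vanish, so the
        omitted projection would have been 0 anyway.\<close>
      then have "lin_inner n (?Q ! i) r = 0" by (simp add: lin_inner_sum[of n _ r] lin_eq_0)
      then show ?thesis using True by simp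
    qed (simp add: lin_inner_commute)
    finally show ?thesis by (simp add: lin_inner_gram_schmidt_step)
  qed
  consider "i < length rs" "j < length rs" | "i < length rs" "j = length rs" | "i = length rs" "j < length rs"
    using snoc.prems by fastforce
  then show ?case
  proof cases
    case 1
    then show ?thesis using snoc by (simp add: nth_append)
  next
    case 2
    then show ?thesis using new[of i] by (simp add: nth_append)
  next
    case 3
    then show ?thesis using new[of j] by (simp add: nth_append lin_inner_commute)
  qed
qed simp

text \<open>The coefficients are chosen before \<open>w\<close>, so the same combination holds for
  evaluation, for the linear coefficients and for the constant term.\<close>

definition in_span :: "terms list \<Rightarrow> terms \<Rightarrow> bool" where
  "in_span rs p \<longleftrightarrow> (\<exists>c. \<forall>w. weigh w p = (\<Sum>k<length rs. c k * weigh w (rs ! k)))"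

lemma in_span_nth:
  assumes "k < length rs"
  shows "in_span rs (rs ! k)"
proof -
  have "(\<Sum>l<length rs. (if l = k then 1 else 0) * weigh w (rs ! l)) = weigh w (rs ! k)" for w
  proof -
    have "(\<Sum>l<length rs. (if l = k then 1 else 0) * weigh w (rs ! l)) = (\<Sum>l<length rs. if l = k then weigh w (rs ! l) else 0)"
      by (intro sum.cong) auto
    then show ?thesis using assms by simp
  qed
  then show ?thesis unfolding in_span_def by metis
qed

lemma in_span_scale_terms: "in_span rs p \<Longrightarrow> in_span rs (scale_terms a p)"
proof -
  assume "in_span rs p"
  then obtain c where "\<And>w. weigh w p = (\<Sum>k<length rs. c k * weigh w (rs ! k))"
    unfolding in_span_def by blast
  then have "weigh w (scale_terms a p) = (\<Sum>k<length rs. (a * c k) * weigh w (rs ! k))" for w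
    by (simp add: weigh_scale_terms sum_distrib_left mult.assoc)
  then show ?thesis unfolding in_span_def by (intro exI[of _ "\<lambda>k. a * c k"]) blast
qed

lemma in_span_append: "in_span rs p \<Longrightarrow> in_span rs q \<Longrightarrow> in_span rs (p @ q)"
proof -
  assume "in_span rs p" "in_span rs q"
  then obtain c d where "\<And>w. weigh w p = (\<Sum>k<length rs. c k * weigh w (rs ! k))"
    "\<And>w. weigh w q = (\<Sum>k<length rs. d k * weigh w (rs ! k))"
    unfolding in_span_def by blast
  then have "weigh w (p @ q) = (\<Sum>k<length rs. (c k + d k) * weigh w (rs ! k))" for w
    by (simp add: sum.distrib distrib_right)
  then show ?thesis unfolding in_span_def by (intro exI[of _ "\<lambda>k. c k + d k"]) blast
qed

lemma in_span_concat: "\<forall>p\<in>set ps. in_span rs p \<Longrightarrow> in_span rs (concat ps)"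
proof (induction ps)
  case Nil
  show ?case unfolding in_span_def by (intro exI[of _ "\<lambda>k. 0"]) simp
qed (simp add: in_span_append)

lemma in_span_snoc:
  assumes "in_span rs p"
  shows "in_span (rs @ [r]) p"
proof -
  obtain c where c: "\<And>w. weigh w p = (\<Sum>k<length rs. c k * weigh w (rs ! k))"
    using assms unfolding in_span_def by blast
  have "weigh w p = (\<Sum>k<length (rs @ [r]). (c(length rs := 0)) k * weigh w ((rs @ [r]) ! k))" for w
    by (auto simp: c nth_append intro!: sum.cong)
  then show ?thesis unfolding in_span_def by blast
qed

lemma in_span_gram_schmidt: "q \<in> set (gram_schmidt n rs) \<Longrightarrow> in_span rs q"
proof (induction rs arbitrary: q rule: rev_induct)
  case (snoc r rs)
  have "in_span (rs @ [r]) r" using in_span_nth[of "length rs" "rs @ [r]"] by simp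
  then have "in_span (rs @ [r]) (gram_schmidt_step n (gram_schmidt n rs) r)"
    unfolding gram_schmidt_step_def
    using snoc.IH by (intro in_span_append in_span_concat) (auto intro: in_span_scale_terms in_span_snoc)
  then show ?case using snoc in_span_snoc by auto
qed simp

lemma in_span_normalise: "in_span rs (normalise n rs i)"
  unfolding normalise_def by (intro in_span_concat) (auto intro: in_span_scale_terms in_span_gram_schmidt)

text \<open>Each step subtracts only multiples of earlier results, so the original polynomials can
  be recovered from the orthogonalised ones.\<close>

lemma weigh_eq_0_gram_schmidt:
  assumes "\<forall>q\<in>set (gram_schmidt n rs). weigh w q = 0" "r \<in> set rs"
  shows "weigh w r = 0"
  using assms
proof (induction rs arbitrary: r rule: rev_induct)
  case (snoc r' rs)
  have "weigh w (gram_schmidt n rs ! k) = 0" if "k < length rs" for k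
    using snoc.prems(1) that by simp
  then have "weigh w r' = 0" using snoc.prems(1) by (simp add: weigh_gram_schmidt_step)
  then show ?case using snoc by auto
qed simp

text \<open>Orthogonality shows that the scaled transpose is a right inverse of the matrix of
  orthogonalised linear parts; the claim is that it is also a left inverse.\<close>

lemma lin_normalise:
  assumes "length rs = n" "lin_independent n rs" "i < n" "j < n"
  shows "lin j (normalise n rs i) = (if i = j then 1 else 0)"
proof -
  let ?Q = "gram_schmidt n rs"
  have pos: "0 < lin_inner n (?Q ! k) (?Q ! k)" if "k < n" for k
    using assms(1,2) that by (simp add: lin_independent_def list_all_length)
  have "(\<Sum>j<n. lin j (?Q ! k) * (lin j (?Q ! l) / lin_inner n (?Q ! l) (?Q ! l))) = (if k = l then 1 else 0)"
    if "k < n" "l < n" for k l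
  proof -
    have "(\<Sum>j<n. lin j (?Q ! k) * (lin j (?Q ! l) / lin_inner n (?Q ! l) (?Q ! l)))
        = lin_inner n (?Q ! k) (?Q ! l) / lin_inner n (?Q ! l) (?Q ! l)"
      unfolding lin_inner_sum[of n "?Q ! k" "?Q ! l"] by (simp add: sum_divide_distrib)
    then show ?thesis
      using pos[of l] gram_schmidt_orthogonal[of k rs l n] assms(1) that by auto
  qed
  from right_inverse_left_inverse[OF this assms(3,4)] show ?thesis
    by (simp add: lin_def[of j "normalise n rs i"] weigh_normalise assms(1) lin_def[of j "?Q ! _"])
qed

text \<open>A vanishing length makes the orthogonalised matrix singular, and its kernel is passed
  back to the original one.\<close>

lemma lin_independent_if_lin_det:
  assumes "length rs = n" "lin_det n rs \<noteq> 0"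
  shows "lin_independent n rs"
proof (rule ccontr)
  let ?Q = "gram_schmidt n rs"
  assume "\<not> lin_independent n rs"
  then obtain k where k: "k < n" "lin_inner n (?Q ! k) (?Q ! k) = 0"
    using lin_inner_nonneg assms(1) by (force simp: lin_independent_def list_all_length not_less intro: antisym)
  have "Determinant.det (matrix_of n (\<lambda>i j. lin j (?Q ! i))) = 0"
  proof -
    \<comment> \<open>Row \<open>k\<close> is zero, so the transpose has a zero column and the
      \<open>k\<close>-th unit vector in its kernel.\<close>
    have "Determinant.det (transpose_mat (matrix_of n (\<lambda>i j. lin j (?Q ! i)))) = 0"
    proof -
      have "transpose_mat (matrix_of n (\<lambda>i j. lin j (?Q ! i))) = matrix_of n (\<lambda>i j. lin i (?Q ! j))"
        by (auto simp: matrix_of_def)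
      moreover have "(\<Sum>j<n. lin i (?Q ! j) * (if j = k then 1 else 0)) = 0" if "i < n" for i
        using lin_eq_0[OF k(2) that] by (intro sum.neutral) auto
      ultimately show ?thesis
        using k(1) by (auto simp: det_eq_0_iff_kernel intro!: exI[of _ "\<lambda>j. if j = k then 1 else 0"])
    qed
    then show ?thesis by (simp add: det_transpose[OF matrix_of_carrier])
  qed
  then obtain v where v: "\<exists>j<n. v j \<noteq> 0" "\<forall>i<n. (\<Sum>j<n. lin j (?Q ! i) * v j) = 0"
    unfolding det_eq_0_iff_kernel by blast
  \<comment> \<open>Differentiation at the origin in direction \<open>v\<close>, which annihilates
    all orthogonalised polynomials.\<close>
  define w where "w = (\<lambda>ks. \<Sum>j<n. v j * lin_weight j ks)"
  have w: "weigh w p = (\<Sum>j<n. lin j p * v j)" for p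
    unfolding w_def by (simp add: weigh_linear_combination lin_def mult.commute)
  have "\<forall>q\<in>set ?Q. weigh w q = 0"
    using v(2) assms(1) by (auto simp: w in_set_conv_nth)
  then have "\<forall>i<n. (\<Sum>j<n. lin j (rs ! i) * v j) = 0"
    using weigh_eq_0_gram_schmidt[of n rs w] assms(1) by (simp add: w)
  then have "lin_det n rs = 0" unfolding lin_det_def det_eq_0_iff_kernel using v(1) by blast
  then show False using assms(2) by blast
qed

section \<open>Affine conjugation to a map with identity linear part\<close>

lemma vars_below_simps [simp]:
  "vars_below n []" "vars_below n (t # p) \<longleftrightarrow> (\<forall>k\<in>set (snd t). k < n) \<and> vars_below n p"
  "vars_below n (p @ q) \<longleftrightarrow> vars_below n p \<and> vars_below n q"
  "vars_below n (scale_terms c p) \<longleftrightarrow> vars_below n p"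
  "vars_below n (concat ps) \<longleftrightarrow> (\<forall>p\<in>set ps. vars_below n p)"
  by (auto simp: vars_below_iff scale_terms_def)

lemma vars_below_normalise:
  assumes "\<forall>r\<in>set rs. vars_below n r"
  shows "vars_below n (normalise m rs i)"
proof -
  have "\<forall>q\<in>set (gram_schmidt m rs). vars_below n q"
    using assms by (induction rs rule: rev_induct) (auto simp: gram_schmidt_step_def)
  then show ?thesis by (simp add: normalise_def)
qed

lemma weigh_mon_decompose:
  assumes "vars_below n p"
  shows "weigh (mon x) p = weigh (\<lambda>ks. if ks = [] then 1 else 0) p + (\<Sum>j<n. x j * lin j p) + weigh (mon x) (higher p)"
proof -
  have "weigh (first_order x) p = (\<Sum>j<n. x j * lin j p)"
  proof -
    have "weigh (first_order x) p = weigh (\<lambda>ks. \<Sum>j<n. x j * lin_weight j ks) p"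
      using assms by (intro weigh_cong first_order_lin_weight) (simp add: vars_below_iff)
    then show ?thesis by (simp add: weigh_linear_combination lin_def)
  qed
  moreover have "weigh (mon x) p = weigh (\<lambda>ks. if ks = [] then 1 else 0) p + weigh (first_order x) p + weigh (mon x) (higher p)"
  proof (induction p)
    case (Cons t p)
    obtain c ks where t: "t = (c, ks)" by (cases t)
    show ?case
    proof (cases ks)
      case Nil
      then show ?thesis using Cons by (simp add: t higher_def first_order_def)
    next
      case (Cons k r)
      then show ?thesis using Cons.IH by (cases r) (simp_all add: t higher_def first_order_def algebra_simps)
    qed
  qed (simp add: higher_def)
  ultimately show ?thesis by simp
qed

lemma sparse_eval_sparse_of:
  "sparse_eval (sparse_of n p) x i = (if i < n then weigh (mon x) (higher (p i)) else 0)"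
proof -
  have "sparse_eval (map (\<lambda>t. (k, t)) q) x i = (if k = i then weigh (mon x) q else 0)" for k q
    by (induction q) auto
  then show ?thesis by (induction n) (auto simp: sparse_of_def)
qed

text \<open>In the source there is the translation by \<open>a\<close>; in the target the matrix
  \<open>M\<close> is applied and the constants \<open>c\<close> are removed. \<open>M\<close> is
  inverse to the Jacobian matrix \<open>J\<close> at \<open>a\<close> because the normalised linear
  parts form the identity matrix.\<close>

lemma same_type_normalise:
  assumes len: "length P = n" and vars: "\<forall>p\<in>set P. vars_below n p"
    and ind: "lin_independent n (map (shift a) P)"
  shows "same_type (stabilise P) (perturb (sparse_of n (normalise n (map (shift a) P))))"
proof -
  define rs where "rs = map (shift a) P"
  define N where "N = normalise n rs"
  have len_rs: "length rs = n" by (simp add: rs_def len)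
  have "\<forall>i. \<exists>c. \<forall>w. weigh w (N i) = (\<Sum>k<n. c k * weigh w (rs ! k))"
    using in_span_normalise[of rs n] unfolding in_span_def len_rs N_def by blast
  then obtain M where M: "\<And>i w. weigh w (N i) = (\<Sum>k<n. M i k * weigh w (rs ! k))" by metis
  define J where "J k j = lin j (rs ! k)" for k j
  have lin_N: "lin j (N i) = (if i = j then 1 else 0)" if "i < n" "j < n" for i j
    using lin_normalise[OF len_rs _ that] ind by (simp add: N_def rs_def)
  have MJ: "(\<Sum>k<n. M i k * J k j) = (if i = j then 1 else 0)" if "i < n" "j < n" for i j
    using M[of "lin_weight j" i] lin_N[OF that] by (simp add: J_def lin_def)
  have JM: "(\<Sum>k<n. J i k * M k j) = (if i = j then 1 else 0)" if "i < n" "j < n" for i j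
    by (rule right_inverse_left_inverse[OF MJ that])
  have cancel: "(\<Sum>k<n. A i k * (\<Sum>l<n. B k l * u l)) = u i"
    if "i < n" and AB: "\<And>i j. i < n \<Longrightarrow> j < n \<Longrightarrow> (\<Sum>k<n. A i k * B k j) = (if i = j then 1 else 0)"
    for A B :: "nat \<Rightarrow> nat \<Rightarrow> real" and u i
  proof -
    have "(\<Sum>k<n. A i k * (\<Sum>l<n. B k l * u l)) = (\<Sum>l<n. (\<Sum>k<n. A i k * B k l) * u l)"
      unfolding sum_distrib_left sum_distrib_right by (subst sum.swap) (simp add: mult.assoc)
    also have "\<dots> = (\<Sum>l<n. if i = l then u l else 0)" using AB \<open>i < n\<close> by (intro sum.cong) auto
    finally show ?thesis using \<open>i < n\<close> by simp
  qed
  define c where "c i = weigh (\<lambda>ks. if ks = [] then 1 else 0) (N i)" for i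
  \<comment> \<open>Beyond \<open>n\<close>, where \<open>stabilise P\<close> is the identity, the
    target has to undo the source translation.\<close>
  define D where "D u i = (if i < n then (\<Sum>k<n. M i k * u k) - c i else u i - a i)" for u :: "nat \<Rightarrow> real" and i
  define D' where "D' u i = (if i < n then (\<Sum>k<n. J i k * (u k + c k)) else u i + a i)" for u :: "nat \<Rightarrow> real" and i
  have "inverse_maps D D'"
    unfolding inverse_maps_def
  proof (intro conjI allI)
    show "smooth_map D" "smooth_map D'"
      unfolding smooth_map_def D_def D'_def by (intro allI smooth_intros finite_lessThan)+
    show "D' (D u) = u" for u
    proof
      fix i show "D' (D u) i = u i"
        using cancel[OF _ JM, of i u] by (auto simp: D_def D'_def)
    qed
    show "D (D' u) = u" for u
    proof
      fix i show "D (D' u) i = u i"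
        using cancel[OF _ MJ, of i "\<lambda>k. u k + c k"] by (auto simp: D_def D'_def)
    qed
  qed
  moreover have "inverse_maps (\<lambda>x k. x k + a k) (\<lambda>x k. x k - a k)"
    unfolding inverse_maps_def smooth_map_def by (auto intro: smooth_intros)
  moreover have "perturb (sparse_of n N) x = D (stabilise P (\<lambda>k. x k + a k))" for x
  proof
    fix i
    show "perturb (sparse_of n N) x i = D (stabilise P (\<lambda>k. x k + a k)) i"
    proof (cases "i < n")
      case True
      have "vars_below n (N i)"
        unfolding N_def using vars by (intro vars_below_normalise) (auto simp: rs_def vars_below_shift)
      have "(\<Sum>j<n. x j * lin j (N i)) = (\<Sum>j<n. if i = j then x j else 0)"
        using lin_N True by (intro sum.cong) auto
      then have "(\<Sum>j<n. x j * lin j (N i)) = x i" using True by simp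
      then have "weigh (mon x) (N i) = c i + x i + weigh (mon x) (higher (N i))"
        using weigh_mon_decompose[OF \<open>vars_below n (N i)\<close>, of x] by (simp add: c_def)
      moreover have "weigh (mon x) (rs ! k) = stabilise P (\<lambda>k. x k + a k) k" if "k < n" for k
        using that by (simp add: rs_def len weigh_shift stabilise_def add.commute)
      ultimately show ?thesis
        using True M[of "mon x" i] by (simp add: D_def perturb_def sparse_eval_sparse_of)
    next
      case False
      then show ?thesis by (simp add: D_def perturb_def sparse_eval_sparse_of stabilise_def len)
    qed
  qed
  ultimately show ?thesis unfolding N_def rs_def by (intro same_type_conjugate)
qed

section \<open>Regular points with natural coordinates\<close>

inductive polynomial_function :: "((nat \<Rightarrow> real) \<Rightarrow> real) \<Rightarrow> bool" where
  const: "polynomial_function (\<lambda>x. c)"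
| coordinate: "polynomial_function (\<lambda>x. x k)"
| add: "polynomial_function f \<Longrightarrow> polynomial_function g \<Longrightarrow> polynomial_function (\<lambda>x. f x + g x)"
| mult: "polynomial_function f \<Longrightarrow> polynomial_function g \<Longrightarrow> polynomial_function (\<lambda>x. f x * g x)"

lemma polynomial_function_sum:
  "finite A \<Longrightarrow> (\<And>k. k \<in> A \<Longrightarrow> polynomial_function (f k)) \<Longrightarrow> polynomial_function (\<lambda>x. \<Sum>k\<in>A. f k x)"
  by (induction A rule: finite_induct) (auto intro: polynomial_function.intros)

lemma polynomial_function_prod:
  "finite A \<Longrightarrow> (\<And>k. k \<in> A \<Longrightarrow> polynomial_function (f k)) \<Longrightarrow> polynomial_function (\<lambda>x. \<Prod>k\<in>A. f k x)"
  by (induction A rule: finite_induct) (auto intro: polynomial_function.intros)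

lemma polynomial_function_univariate:
  "polynomial_function f \<Longrightarrow> \<exists>q. \<forall>s. f (x(i := s)) = poly q s"
proof (induction rule: polynomial_function.induct)
  case (const c)
  show ?case by (rule exI[of _ "[:c:]"]) simp
next
  case (coordinate k)
  show ?case by (rule exI[of _ "if k = i then [:0, 1:] else [:x k:]"]) simp
next
  case (add f g)
  then show ?case by (metis poly_add)
next
  case (mult f g)
  then show ?case by (metis poly_mult)
qed

text \<open>The coordinates are replaced one at a time: in a single coordinate the function is a
  nonzero univariate polynomial, which has only finitely many roots.\<close>

lemma polynomial_function_nonzero_at_nats:
  assumes "polynomial_function f" "f x \<noteq> 0"
  shows "\<exists>y. f y \<noteq> 0 \<and> (\<forall>k<n. y k \<in> \<nat>) \<and> (\<forall>k\<ge>n. y k = x k)"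
proof (induction n)
  case 0
  then show ?case using assms(2) by (intro exI[of _ x]) auto
next
  case (Suc n)
  then obtain y where y: "f y \<noteq> 0" "\<forall>k<n. y k \<in> \<nat>" "\<forall>k\<ge>n. y k = x k" by blast
  obtain q where q: "\<And>s. f (y(n := s)) = poly q s"
    using polynomial_function_univariate[OF assms(1)] by metis
  have "poly q (y n) \<noteq> 0" using q[of "y n"] y(1) by simp
  then have "q \<noteq> 0" by auto
  then have "finite {s. poly q s = 0}" by (rule poly_roots_finite)
  moreover have "infinite (\<nat> :: real set)"
    using finite_imageD[of real UNIV] by (auto simp: Nats_def inj_on_def)
  ultimately have "\<not> \<nat> \<subseteq> {s. poly q s = 0}" using finite_subset by blast
  then obtain s where "s \<in> \<nat>" "poly q s \<noteq> 0" by blast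
  then have "f (y(n := s)) \<noteq> 0" by (simp only: q not_False_eq_True)
  moreover have "\<forall>k<Suc n. (y(n := s)) k \<in> \<nat>" "\<forall>k\<ge>Suc n. (y(n := s)) k = x k"
    using y(2,3) \<open>s \<in> \<nat>\<close> by (auto simp: less_Suc_eq)
  ultimately show ?case by blast
qed

lemma polynomial_function_weigh_shift: "polynomial_function (\<lambda>a. weigh w (shift a p))"
proof -
  have step: "weigh w (shift_step a k q) = a k * weigh w q + weigh (\<lambda>ks. w (k # ks)) q" for w a k q
    by (induction q) (auto simp: shift_step_def algebra_simps)
  \<comment> \<open>The last factor is peeled off, and multiplication by its variable is absorbed
    into the weight; hence \<open>w\<close> must be arbitrary in the induction.\<close>
  have "polynomial_function (\<lambda>a. weigh w (foldl (\<lambda>q k. shift_step a k q) q ks))" for w q ks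
    by (induction ks arbitrary: w rule: rev_induct) (auto simp: step intro!: polynomial_function.intros)
  then show ?thesis
    unfolding shift_def weigh_concat_map sum_list_map_nth by (intro polynomial_function_sum) auto
qed

lemma polynomial_function_lin_det:
  assumes "length P = n"
  shows "polynomial_function (\<lambda>a. lin_det n (map (shift a) P))"
proof -
  have "lin_det n (map (shift a) P) = (\<Sum>p\<in>{p. p permutes {0..<n}}. signof p *
      (\<Prod>i\<in>{0..<n}. weigh (lin_weight (if p i < n then p i else 0)) (shift a (P ! i))))" for a
    unfolding lin_det_def det_def'[OF matrix_of_carrier]
    by (intro sum.cong prod.cong arg_cong2[where f = "(*)"] refl)
       (auto simp: matrix_of_def assms lin_def dest: permutes_in_image)
  then show ?thesis
    using finite_permutations[of "{0..<n}"]
    by (simp only:) (auto intro!: polynomial_function_sum polynomial_function_prod polynomial_function.intros polynomial_function_weigh_shift)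
qed

lemma count_point_replicates:
  "count_point (concat (map (\<lambda>k. replicate (d k) k) [0..<n])) j = (if j < n then real (d j) else 0)"
proof -
  have "count_point (xs @ ys) j = count_point xs j + count_point ys j" for xs ys
    by (simp add: count_point_def)
  moreover have "count_point (replicate l k) j = (if j = k then real l else 0)" for l k
    by (induction l) (auto simp: count_point_def)
  moreover have "count_point [] j = 0" by (simp add: count_point_def)
  ultimately show ?thesis by (induction n) auto
qed

text \<open>The Jacobian determinant is a polynomial in the point, so it is nonzero at some point
  with natural coordinates. A list that repeats each index as often as its coordinate demands
  encodes that point.\<close>

lemma exists_regular_point:
  assumes P: "presents n P F" and F: "nondegenerate n F"
  shows "\<exists>as. set as \<subseteq> {..<n} \<and> regular_at P as"
proof -
  have len: "length P = n" and vars: "\<forall>p\<in>set P. vars_below n p" using P by (auto simp: presents_def)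
  obtain x where "x \<in> carrier_vec n" "jacobian_det n F x \<noteq> 0" using F by (auto simp: nondegenerate_def)
  then have "lin_det n (map (shift (coords n x)) P) \<noteq> 0" by (simp add: jacobian_det_eq[OF P])
  then obtain y where y: "lin_det n (map (shift y) P) \<noteq> 0" "\<forall>k<n. y k \<in> \<nat>"
    using polynomial_function_nonzero_at_nats[OF polynomial_function_lin_det[OF len], of "coords n x" n] by blast
  have "\<forall>k. \<exists>d. k < n \<longrightarrow> y k = real d" using y(2) by (auto elim!: Nats_cases)
  then obtain d where d: "\<And>k. k < n \<Longrightarrow> y k = real (d k)" by metis
  define as where "as = concat (map (\<lambda>k. replicate (d k) k) [0..<n])"
  have "map (shift y) P = map (shift (count_point as)) P"
    by (rule map_shift_cong[OF len vars]) (simp add: as_def count_point_replicates d)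
  then have "lin_det n (map (shift (count_point as)) P) \<noteq> 0" using y(1) by metis
  then have "regular_at P as"
    using lin_independent_if_lin_det[of "map (shift (count_point as)) P" n] by (simp add: regular_at_def len)
  moreover have "set as \<subseteq> {..<n}" by (auto simp: as_def)
  ultimately show ?thesis by blast
qed

section \<open>Correctness\<close>

lemma while_eq_funpow:
  assumes "\<not> b ((f ^^ k) x)"
  shows "\<exists>j. while b f x = (f ^^ j) x \<and> \<not> b ((f ^^ j) x)"
  using assms
proof (induction k arbitrary: x)
  case 0
  then show ?case by (intro exI[of _ 0]) (simp add: while_unfold[of b f x])
next
  case (Suc k)
  show ?case
  proof (cases "b x")
    case True
    obtain j where "while b f (f x) = (f ^^ j) (f x)" "\<not> b ((f ^^ j) (f x))"
      using Suc.IH[of "f x"] Suc.prems by (auto simp: funpow_swap1)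
    then show ?thesis using True
      by (intro exI[of _ "Suc j"]) (simp add: while_unfold[of b f x] funpow_swap1)
  next
    case False
    then show ?thesis by (intro exI[of _ 0]) (simp add: while_unfold[of b f x])
  qed
qed

lemma funpow_halts:
  fixes \<mu> :: "'a \<Rightarrow> nat"
  assumes "\<And>x. b x \<Longrightarrow> \<mu> (f x) < \<mu> x"
  shows "\<exists>k. \<not> b ((f ^^ k) x)"
proof (induction "\<mu> x" arbitrary: x rule: less_induct)
  case less
  show ?case
  proof (cases "b x")
    case True
    then obtain k where "\<not> b ((f ^^ k) (f x))" using less assms by blast
    then show ?thesis by (intro exI[of _ "Suc k"]) (simp add: funpow_swap1)
  next
    case False
    then show ?thesis by (intro exI[of _ 0]) simp
  qed
qed

text \<open>Entries of length 2 and 3 leave the worklist. One of length \<open>d \<ge> 4\<close> is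
  replaced by entries of lengths \<open>d - 1\<close>, \<open>d - 2\<close> and 3, so base 3 makes
  the total weight drop.\<close>

lemma reduction_halts: "\<exists>k. \<not> pending ((reduce_step ^^ k) s)"
proof (rule funpow_halts)
  let ?\<mu> = "\<lambda>s :: nat \<times> nat \<times> sparse \<times> sparse. \<Sum>u\<leftarrow>fst (snd (snd s)). 3 ^ length (snd (snd u)) :: nat"
  show "?\<mu> (reduce_step s) < ?\<mu> s" if p: "pending s" for s
  proof -
    obtain t m w out where s: "s = (t, m, w, out)" by (metis prod.collapse)
    obtain i c ks w' where w: "w = (i, c, ks) # w'"
      using p by (cases w) (auto simp: pending_def s)
    \<comment> \<open>For an entry of length \<open>l + 4\<close> the required bound
      \<open>3^(l+3) + 3^(l+2) + 27 < 3^(l+4)\<close> is 9 times this one.\<close>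
    have "3 < 5 * (3 :: nat) ^ l" for l using one_le_power[of "3 :: nat" l] by linarith
    then show ?thesis
      by (auto simp: reduce_step_def reduce_def s w split: list.split)
  qed
qed

section \<open>Correctness of the reduction to cubic terms\<close>

lemma perturb_cong: "(\<And>x i. sparse_eval S x i = sparse_eval S' x i) \<Longrightarrow> perturb S = perturb S'"
  by (auto simp: perturb_def fun_eq_iff)

text \<open>Indices from \<open>m\<close> on are fresh. Component \<open>t\<close> is excluded so
  that the map preserves coordinate \<open>t\<close>, which may still occur as a variable.\<close>

definition below :: "nat \<Rightarrow> nat \<Rightarrow> sparse \<Rightarrow> bool" where
  "below t m S \<longleftrightarrow> (\<forall>u\<in>set S. fst u < m \<and> fst u \<noteq> t \<and> (\<forall>k\<in>set (snd (snd u)). k < m))"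

lemma below_simps [simp]:
  "below t m []"
  "below t m (u # S) \<longleftrightarrow> fst u < m \<and> fst u \<noteq> t \<and> (\<forall>k\<in>set (snd (snd u)). k < m) \<and> below t m S"
  "below t m (S @ S') \<longleftrightarrow> below t m S \<and> below t m S'"
  by (auto simp: below_def)

lemma below_homogenise: "t < m \<Longrightarrow> below t m S \<Longrightarrow> below t m (homogenise t S)"
  by (induction S) auto

lemma below_mono: "below t m S \<Longrightarrow> m \<le> m' \<Longrightarrow> below t m' S"
  by (induction S) (auto intro: less_le_trans)

lemma below_fresh:
  assumes "below t m S" "m \<le> y"
  shows "no_component t S" "no_component y S" "no_variable y S"
  using assms by (force simp: below_def no_component_def no_variable_def)+

text \<open>Entries of \<open>w\<close> count through their homogenisation and those of
  \<open>out\<close> as they stand, so an empty worklist leaves a purely cubic perturbation of the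
  same type as \<open>S\<close>.\<close>

definition reduction_invariant :: "nat \<Rightarrow> sparse \<Rightarrow> nat \<times> nat \<times> sparse \<times> sparse \<Rightarrow> bool" where
  "reduction_invariant n S s \<longleftrightarrow> (case s of (t, m, w, out) \<Rightarrow> t = n \<and> n < m \<and> below n m w \<and> below n m out \<and>
     (\<forall>u\<in>set w. 2 \<le> length (snd (snd u))) \<and> (\<forall>u\<in>set out. length (snd (snd u)) = 3) \<and>
     same_type (perturb S) (perturb (homogenise n w @ out)))"

text \<open>By the length of the first entry: 2 is already cubic once homogenised, 3 is a quintic
  term, and from 4 on the term is split into two factors.\<close>

lemma reduction_invariant_step:
  assumes "reduction_invariant n S s"
  shows "reduction_invariant n S (reduce_step s)"
proof -
  obtain t m w out where s: "s = (t, m, w, out)" by (metis prod.collapse)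
  have t: "t = n" and m: "n < m" and w: "below n m w" and out: "below n m out"
    and w2: "\<forall>u\<in>set w. 2 \<le> length (snd (snd u))" and out3: "\<forall>u\<in>set out. length (snd (snd u)) = 3"
    and same: "same_type (perturb S) (perturb (homogenise n w @ out))"
    using assms by (auto simp: reduction_invariant_def s)
  show ?thesis
  proof (cases w)
    case Nil
    then show ?thesis using assms by (simp add: reduce_step_def s)
  next
    case (Cons u w')
    obtain i c ks where u: "u = (i, c, ks)" by (metis prod.collapse)
    have "2 \<le> length ks" using w2 by (simp add: Cons u)
    then obtain a b k2 where ks: "ks = a # b # k2" by (cases ks; cases "tl ks") auto
    define L where "L = homogenise n w' @ out"
    have L: "below n m L" using w out m by (simp add: L_def below_homogenise Cons)
    have i: "i < m" "i \<noteq> n" and vars: "a < m" "b < m" "\<forall>k\<in>set k2. k < m"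
      using w by (auto simp: Cons u ks)
    have w': "below n m w'" and w2': "\<forall>u\<in>set w'. 2 \<le> length (snd (snd u))" using w w2 by (auto simp: Cons)
    have same': "same_type (perturb S) (perturb ((i, c, replicate (Suc (length k2)) n @ a # b # k2) # L))"
      using same by (simp add: Cons u ks L_def)
    show ?thesis
    proof (cases k2)
      case Nil
      have "perturb ((i, c, replicate (Suc (length k2)) n @ a # b # k2) # L) =
          perturb (homogenise n w' @ (i, c, [n, a, b]) # out)"
        by (rule perturb_cong) (simp add: Nil L_def)
      then show ?thesis
        using same' w' w2' out out3 m i vars
        by (simp add: reduction_invariant_def s Cons u ks Nil t reduce_step_def reduce_def)
    next
      case k2: (Cons d k3)
      show ?thesis
      proof (cases k3)
        case Nil
        have "same_type (perturb S) (perturb ((i, c, [n, n] @ [a, b, d]) # L))"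
          using same' by (simp add: k2 Nil)
        also have "same_type (perturb ((i, c, [n, n] @ [a, b, d]) # L))
            (perturb ((i, c, [n, n, m]) # (m, - 1, [a, b, d]) # L))"
          using m i vars by (intro same_type_quintic below_fresh[OF L]) (auto simp: k2)
        also have "perturb ((i, c, [n, n, m]) # (m, - 1, [a, b, d]) # L) =
            perturb (homogenise n w' @ (i, c, [n, n, m]) # (m, - 1, [a, b, d]) # out)"
          by (rule perturb_cong) (simp add: L_def)
        finally show ?thesis
          using w' w2' out out3 m i vars
          by (auto simp: reduction_invariant_def s Cons u ks k2 Nil t reduce_step_def reduce_def intro: below_mono)
      next
        case k3: (Cons h k4)
        \<comment> \<open>The factors are the homogenisations of \<open>[a, b]\<close> and
          \<open>k2\<close>. With the one remaining \<open>t\<close> they make up the whole term,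
          and the products with a fresh variable are homogenised terms again.\<close>
        define as where "as = [n, a, b]"
        define bs where "bs = replicate (Suc (length k4)) n @ k2"
        have vars_as: "\<forall>k\<in>set as. k < m" and vars_bs: "\<forall>k\<in>set bs. k < m"
          using vars m by (auto simp: as_def bs_def)
        have "perturb ((i, c, replicate (Suc (length k2)) n @ a # b # k2) # L) = perturb ((i, c, n # as @ bs) # L)"
          by (rule perturb_cong) (simp add: as_def bs_def k2 k3 algebra_simps)
        then have "same_type (perturb S) (perturb ((i, c, n # as @ bs) # L))" using same' by simp
        also have "same_type (perturb ((i, c, n # as @ bs) # L)) (perturb ((i, c, n # m # bs) # (m + 1, - 1, bs) #
            (i, c, n # (m + 1) # as) # (i, - c, [n, m, m + 1]) # (m, - 1, as) # L))"
          using m i vars_as vars_bs by (intro same_type_split below_fresh[OF L]) auto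
        also have "perturb ((i, c, n # m # bs) # (m + 1, - 1, bs) #
            (i, c, n # (m + 1) # as) # (i, - c, [n, m, m + 1]) # (m, - 1, as) # L) =
            perturb (homogenise n ((i, c, m # k2) # (m + 1, - 1, k2) # (i, c, [m + 1, a, b]) # w') @
              (i, - c, [n, m, m + 1]) # (m, - 1, [n, a, b]) # out)"
          by (rule perturb_cong) (simp add: L_def as_def bs_def k2 k3 algebra_simps)
        finally have new: "same_type (perturb S) (perturb (homogenise n ((i, c, m # k2) # (m + 1, - 1, k2) # (i, c, [m + 1, a, b]) # w') @
              (i, - c, [n, m, m + 1]) # (m, - 1, [n, a, b]) # out))" .
        have step: "reduce_step s = (n, m + 1 + 1, (i, c, m # k2) # (m + 1, - 1, k2) # (i, c, [m + 1, a, b]) # w',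
              (i, - c, [n, m, m + 1]) # (m, - 1, [n, a, b]) # out)"
          by (simp add: s Cons u ks k2 k3 t reduce_step_def reduce_def)
        have "below n (m + 1 + 1) w'" "below n (m + 1 + 1) out" using w' out by (auto intro: below_mono)
        moreover have "2 \<le> length k2" by (simp add: k2 k3)
        moreover have "\<forall>k\<in>set k2. k < m + 1 + 1" using vars by auto
        ultimately show ?thesis
          unfolding reduction_invariant_def step prod.case
          using new m i vars w2' out3 by (intro conjI) (simp_all del: homogenise_simps)
      qed
    qed
  qed
qed

lemma reduction_correct:
  assumes S: "\<forall>u\<in>set S. fst u < n \<and> 2 \<le> length (snd (snd u)) \<and> (\<forall>k\<in>set (snd (snd u)). k < n)"
  obtains m out where "reduction n S = (n, m, [], out)" "\<forall>u\<in>set out. fst u < m \<and> length (snd (snd u)) = 3 \<and> (\<forall>k\<in>set (snd (snd u)). k < m)"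
    "same_type (perturb S) (perturb out)"
proof -
  obtain k' where "\<not> pending ((reduce_step ^^ k') (n, n + 1, S, []))"
    using reduction_halts by blast
  from while_eq_funpow[where b = pending, OF this] obtain k where
    k: "reduction n S = (reduce_step ^^ k) (n, n + 1, S, [])" "\<not> pending (reduction n S)"
    unfolding reduction_def by metis
  have "same_type (perturb S) (perturb (homogenise n S))"
    using S by (intro same_type_homogenise) (auto simp: no_component_def no_variable_def)
  then have "reduction_invariant n S (n, n + 1, S, [])"
    using S by (auto simp: reduction_invariant_def below_def less_Suc_eq)
  then have inv: "reduction_invariant n S ((reduce_step ^^ k) (n, n + 1, S, []))" for k
    by (induction k) (auto intro: reduction_invariant_step)
  obtain t m w out where s: "reduction n S = (t, m, w, out)" by (metis prod.collapse)
  have "w = []" using k(2) by (cases w) (auto simp: s pending_def)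
  moreover have "reduction_invariant n S (t, m, w, out)" using inv k(1) s by metis
  ultimately have "t = n" "below n m out" "\<forall>u\<in>set out. length (snd (snd u)) = 3" "same_type (perturb S) (perturb out)"
    by (auto simp: reduction_invariant_def)
  then show ?thesis using that[of m out] s \<open>w = []\<close> by (auto simp: below_def)
qed

lemma dense_correct:
  assumes S: "\<forall>u\<in>set S. fst u < m \<and> length (snd (snd u)) = 3 \<and> (\<forall>k\<in>set (snd (snd u)). k < m)"
  obtains G where "presents m (dense m S) G" "cubic_homogeneous_type m G" "stabilise (dense m S) = perturb S"
proof -
  define h where "h i = map (\<lambda>u. snd u) (filter (\<lambda>u. fst u = i) S)" for i
  have nth: "dense m S ! i = (1, [i]) # h i" if "i < m" for i using that by (simp add: dense_def h_def)
  have len: "length (dense m S) = m" by (simp add: dense_def)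
  have h_vars: "vars_below m (h i)" and h_cubic: "homogeneous 3 (h i)" for i
    using S by (auto simp: h_def vars_below_iff homogeneous_def case_prod_beta)
  define G where "G v = Matrix.vec m (\<lambda>i. eval_terms (dense m S ! i) v)" for v
  define H where "H v = Matrix.vec m (\<lambda>i. eval_terms (h i) v)" for v
  have "presents m (dense m S) G"
    using h_vars by (auto simp: presents_def len G_def dense_def h_def[symmetric])
  moreover have "presents m (map h [0..<m]) H"
    using h_vars by (auto simp: presents_def H_def)
  moreover have "G v = v + H v" if "v \<in> carrier_vec m" for v
    using that by (intro eq_vecI) (auto simp: G_def H_def nth eval_terms_def)
  moreover have "stabilise (dense m S) = perturb S"
  proof (intro ext)
    fix x i
    have "weigh (mon x) (h i) = sparse_eval S x i"
      unfolding h_def by (induction S) auto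
    moreover have "sparse_eval S x i = 0" if "\<not> i < m"
      using that S by (intro sparse_eval_no_component) (auto simp: no_component_def)
    ultimately show "stabilise (dense m S) x i = perturb S x i"
      by (simp add: stabilise_def len nth perturb_def)
  qed
  ultimately show ?thesis
    using h_cubic by (intro that[of G]) (auto simp: cubic_homogeneous_type_def intro!: exI[of _ H] exI[of _ "map h [0..<m]"])
qed

section \<open>Assembly of the algorithm\<close>

lemma sparse_of_mem:
  assumes "u \<in> set (sparse_of n p)"
  shows "fst u < n" "snd u \<in> set (p (fst u))" "2 \<le> length (snd (snd u))"
proof -
  have "2 \<le> length (snd t)" if "t \<in> set (higher q)" for t q
    using that by (auto simp: higher_def split: list.splits)
  then show "2 \<le> length (snd (snd u))" using assms by (auto simp: sparse_of_def)
  show "fst u < n" "snd u \<in> set (p (fst u))" using assms by (auto simp: sparse_of_def higher_def)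
qed

lemma cubic_form_correct:
  assumes P: "presents n P F" and reg: "regular_at P as"
  obtains m G where "presents m (cubic_form (map (\<lambda>p. shift (count_point as) p) P)) G" "cubic_homogeneous_type m G"
    "nonsingular n F \<longleftrightarrow> nonsingular m G" "\<And>b. b > 0 \<Longrightarrow> fibers_at_most n F b \<longleftrightarrow> fibers_at_most m G b"
proof -
  let ?rs = "map (shift (count_point as)) P"
  let ?S = "sparse_of n (normalise n ?rs)"
  have len: "length P = n" and vars: "\<forall>p\<in>set P. vars_below n p" using P by (auto simp: presents_def)
  have "vars_below n (normalise n ?rs i)" for i
    using vars by (intro vars_below_normalise) (auto simp: vars_below_shift)
  then have "\<forall>u\<in>set ?S. fst u < n \<and> 2 \<le> length (snd (snd u)) \<and> (\<forall>k\<in>set (snd (snd u)). k < n)"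
    using sparse_of_mem by (fastforce simp: vars_below_iff)
  then obtain m out where out: "reduction n ?S = (n, m, [], out)"
    "\<forall>u\<in>set out. fst u < m \<and> length (snd (snd u)) = 3 \<and> (\<forall>k\<in>set (snd (snd u)). k < m)"
    "same_type (perturb ?S) (perturb out)"
    by (rule reduction_correct)
  obtain G where G: "presents m (dense m out) G" "cubic_homogeneous_type m G" "stabilise (dense m out) = perturb out"
    using out(2) by (rule dense_correct)
  have "same_type (stabilise P) (perturb ?S)"
    using reg by (intro same_type_normalise[OF len vars]) (simp add: regular_at_def len)
  then have same: "same_type (stabilise P) (stabilise (dense m out))"
    unfolding G(3) using out(3) by (rule same_type_trans)
  have "cubic_form ?rs = dense m out" by (simp add: cubic_form_def len out(1))
  moreover have "nonsingular n F \<longleftrightarrow> nonsingular m G"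
    using same by (simp add: nonsingular_iff[OF P] nonsingular_iff[OF G(1)] same_type_def)
  moreover have "fibers_at_most n F b \<longleftrightarrow> fibers_at_most m G b" if "b > 0" for b
    using same that by (simp add: fibers_at_most_iff[OF P] fibers_at_most_iff[OF G(1)] same_type_def)
  ultimately show ?thesis using that[of m G] G(1,2) by simp
qed

text \<open>Every index list is met after as many steps as its length, so the search misses no
  candidate.\<close>

lemma search_steps:
  "fst ((search_step ^^ k) (P, [[]])) = P"
  "set (snd ((search_step ^^ k) (P, [[]]))) = {as. length as = k \<and> set as \<subseteq> {..<length P}}"
proof (induction k)
  case (Suc k)
  {
    case 1
    then show ?case using Suc by (simp add: search_step_def)
  next
    case 2
    have "set (snd (search_step s)) = {j # as | j as. as \<in> set (snd s) \<and> j < length (fst s)}" for s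
      by (auto simp: search_step_def)
    with Suc show ?case by (auto simp: length_Suc_conv)
  }
qed auto

theorem theorem3p9:
  "\<exists>A :: prog. \<forall>(n :: nat) (F :: real Matrix.vec \<Rightarrow> real Matrix.vec).
     polynomial_map n F \<and> nondegenerate n F \<longrightarrow>
     (\<forall>P. presents n P F \<longrightarrow>
       (\<exists>(m :: nat) (G :: real Matrix.vec \<Rightarrow> real Matrix.vec) Q.
          exec A (data_of_map P) (data_of_map Q) \<and> presents m Q G \<and>
          cubic_homogeneous_type m G \<and>
          (nonsingular n F \<longleftrightarrow> nonsingular m G) \<and>
          (\<forall>b :: nat. b > 0 \<longrightarrow> (fibers_at_most n F b \<longleftrightarrow> fibers_at_most m G b))))"
proof -
  have red: "computable e state_code (\<lambda>z. reduction (n z) (S z))"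
    if "computable e nat_code n" "computable e sparse_code S" for e n and S :: "'a \<Rightarrow> sparse"
    unfolding reduction_def using reduction_halts
    by (intro computable_while[OF computable_pending computable_reduce_step])
       ((rule that computable_intros)+, blast)
  have cubic: "computable e (list_code poly_code) (\<lambda>z. cubic_form (rs z))"
    if "computable e (list_code poly_code) rs" for e and rs :: "'a \<Rightarrow> terms list"
    unfolding cubic_form_def Let_def
    by ((rule that that[THEN computable_compose] computable_intros red)+)
  have "computable (list_code poly_code) search_code (\<lambda>P. (P, [[]]))" by ((rule computable_intros)+)
  moreover have "computable search_code (list_code poly_code) finish"
    unfolding finish_def[abs_def] by ((rule computable_intros cubic)+)
  \<comment> \<open>\<open>p\<close> sets up the search, \<open>t\<close> and \<open>f\<close> are
    the test and body of its loop, and \<open>q\<close> finishes. The loop is added outside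
    \<open>computable\<close>, as it halts only if a regular point exists.\<close>
  ultimately obtain p q t f where
    p: "\<And>P. exec p (data_of_map P) (search_code (P, [[]]))" and
    q: "\<And>s. exec q (search_code s) (data_of_map (finish s))" and
    t: "\<And>s. exec t (search_code s) (bool_code (searching s))" and
    f: "\<And>s. exec f (search_code s) (search_code (search_step s))"
    using computable_searching computable_search_step unfolding computable_def data_of_map_code by blast
  show ?thesis
  proof (rule exI[of _ "Seq p (Seq (While t f) q)"], intro allI impI)
    fix n F P
    assume "polynomial_map n F \<and> nondegenerate n F" and P: "presents n P F"
    then obtain as where as: "set as \<subseteq> {..<n}" "regular_at P as" using exists_regular_point by blast
    have len: "length P = n" using P by (simp add: presents_def)
    \<comment> \<open>\<open>as\<close> serves to bound the number of rounds: it is among the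
      candidates of its own length.\<close>
    have halt: "\<not> searching ((search_step ^^ length as) (P, [[]]))"
      using as search_steps[of "length as" P] by (auto simp: searching_def list_all_iff len)
    define s where "s = while searching search_step (P, [[]])"
    obtain k where s: "s = (search_step ^^ k) (P, [[]])" "\<not> searching s"
      using while_eq_funpow[where b = searching, OF halt] unfolding s_def by metis
    have "exec (Seq p (Seq (While t f) q)) (data_of_map P) (data_of_map (finish s))"
      unfolding s_def using exec_While[where b = searching, OF t f halt] by (intro exec.Seq[OF p] exec.Seq[OF _ q])
    \<comment> \<open>\<open>bs\<close> is the candidate actually found, possibly different from
      \<open>as\<close>.\<close>
    moreover obtain bs where bs: "regular_at P bs" "finish s = cubic_form (map (\<lambda>p. shift (count_point bs) p) P)"
    proof -
      have fst: "fst s = P" unfolding s(1) by (rule search_steps)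
      have "filter (\<lambda>as. regular_at P as) (snd s) \<noteq> []"
        using s(2) by (auto simp: searching_def fst list_all_iff filter_empty_conv)
      then obtain bs r where "filter (\<lambda>as. regular_at P as) (snd s) = bs # r" by (cases "filter (\<lambda>as. regular_at P as) (snd s)") auto
      moreover from this have "regular_at P bs" by (metis filter_eq_ConsD)
      ultimately show ?thesis using that by (simp add: finish_def fst)
    qed
    ultimately show "\<exists>m G Q. exec (Seq p (Seq (While t f) q)) (data_of_map P) (data_of_map Q) \<and>
        presents m Q G \<and> cubic_homogeneous_type m G \<and> (nonsingular n F \<longleftrightarrow> nonsingular m G) \<and>
        (\<forall>b>0. fibers_at_most n F b \<longleftrightarrow> fibers_at_most m G b)"
      using cubic_form_correct[OF P bs(1)] by metis
  qed
qed

end
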